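(* Let $\alpha,\beta\in\mathcal U\cup\mathcal L\cup\mathcal V$. For every PP-pattern $\langle\alpha,pe,\beta\rangle$ there exists an LDQL query $q$ such that $[\![\langle\alpha,pe,\beta\rangle]\!]^{\mathsf{ctxt}}_W=[\![q]\!]^{\emptyset}_W$ for every Web of Linked Data $W$.
   Context: **Data model.** $\mathcal U$ (URIs), $\mathcal B$ (blank nodes), $\mathcal L$ (literals), $\mathcal V$ (variables, written $?v,?x,\dots$) and $\mathcal D$ (documents) are pairwise disjoint infinite sets. An RDF triple is an element of $\mathcal T=(\mathcal U\cup\mathcal B)\times\mathcal U\times(\mathcal U\cup\mathcal B\cup\mathcal L)$; $\mathrm{uris}(t)$ is the set of URIs in the triple $t$. Each document $d$ carries a finite set of triples $\mathrm{data}(d)\subseteq\mathcal T$, distinct documents using disjoint sets of blank nodes. A Web of Linked Data is $W=\langle D,adoc\rangle$ with $D\subseteq\mathcal D$ finite and $adoc:\mathcal U\to D$ a partial surjective function with domain $\mathrm{dom}(adoc)$. When quantifying over all Webs, the assignment $\mathrm{data}$ also varies over all possibilities. The link graph $\mathcal G_W$ has node set $D$ and edges $\langle d,(t,u),d'\rangle$ for all $d\in D$, $t\in\mathrm{data}(d)$, $u\in\mathrm{uris}(t)\cap\mathrm{dom}(adoc)$, $d'=adoc(u)$. **SPARQL.** A solution mapping $\mu$ is a partial function with finite domain from $\mathcal V$ to $\mathcal U\cup\mathcal B\cup\mathcal L$; $\mu[\alpha]=\mu(\alpha)$ if $\alpha\in\mathrm{dom}(\mu)$, else $\mu[\alpha]=\alpha$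 (extended componentwise to triples). $\mu,\mu'$ are compatible if they agree on $\mathrm{dom}(\mu)\cap\mathrm{dom}(\mu')$. $\Omega_1\Join\Omega_2=\{\mu_1\cup\mu_2\mid\mu_i\in\Omega_i\text{ compatible}\}$. An RDF dataset $\mathfrak D$ consists of a default graph and finitely or infinitely many named graphs $\langle u,G_u\rangle$ with pairwise distinct names $u\in\mathcal U$. Graph patterns: finite sets $B$ of triple patterns from $(\mathcal U\cup\mathcal L\cup\mathcal V)\times(\mathcal U\cup\mathcal V)\times(\mathcal U\cup\mathcal L\cup\mathcal V)$ (basic graph patterns, possibly the empty one $\{\,\}$; a triple pattern is identified with a singleton), and $(P_1\,\mathsf{AND}\,P_2)$, $(P_1\,\mathsf{UNION}\,P_2)$, $(P_1\,\mathsf{OPT}\,P_2)$, $(P_1\,\mathsf{FILTER}\,R)$, $(\mathsf{GRAPH}\ c\ P_1)$ with $c\in\mathcal U\cup\mathcal V$, $(P_1\,\mathsf{BIND}(e\,\mathsf{AS}\,?v))$ with $e\in\mathcal U\cup\mathcal L\cup\mathcal V$ and $?v$ not occurring in $P_1$. Filter conditions are Boolean combinations of $\mathrm{bound}(?x)$, $?x=c$, $?x=?y$ (atoms with an unbound variable are false). Evaluation $[\![P]\!]^{\mathfrak D}_G$: $[\![B]\!]=\{\mu\mid\mathrm{dom}(\mu)=\mathrm{var}(B),\mu[B]\subseteq G\}$; $\mathsf{AND}$ is $\Join$; $\mathsf{UNION}$ is $\cup$; $\mathsf{OPT}$ gives $(\Omega_1\Join\Omega_2)\cup\{\mu\in\Omega_1\mid\text{no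 }\mu'\in\Omega_2\text{ compatible with }\mu\}$; $\mathsf{FILTER}$ selects the mappings satisfying $R$; $[\![\mathsf{GRAPH}\ u\ P_1]\!]^{\mathfrak D}_G=[\![P_1]\!]^{\mathfrak D}_{G_u}$ ($G_u=\emptyset$ if $u$ is not a name in $\mathfrak D$); $[\![\mathsf{GRAPH}\ ?x\ P_1]\!]^{\mathfrak D}_G=\bigcup_{u\text{ name in }\mathfrak D}([\![P_1]\!]^{\mathfrak D}_{G_u}\Join\{\{?x\mapsto u\}\})$; $\mathsf{BIND}$ extends each mapping $\mu$ by $?v\mapsto\mu[e]$ (leaving $\mu$ unchanged if $e$ is an unbound variable). **LDQL.** A link pattern is a tuple in $(\mathcal U\cup\{\_,+\})\times(\mathcal U\cup\{\_,+\})\times(\mathcal U\cup\mathcal L\cup\{\_,+\})$. An edge with label $(\langle x_1,x_2,x_3\rangle,u)$ matches $\langle y_1,y_2,y_3\rangle$ in the context of URI $u_c$ if (1) some $i$ has $y_i=\_$ and $x_i=u$, and (2) for each $i$: $y_i=+$ and $x_i=u_c$, or $y_i=x_i$, or $y_i=\_$. LDQL queries $q$ and link path expressions (LPEs) $lpe$ are given by $q:=\langle lpe,P\rangle\mid(\mathsf{SEED}\ U\ q)\mid(\mathsf{SEED}\ ?v\ q)\mid(q\,\mathsf{AND}\,q)\mid(q\,\mathsf{UNION}\,q)\mid\pi_Vq$, $lpe:=\varepsilon\mid lp\mid lpe/lpe\mid lpe|lpe\mid lpe^*\mid[lpe]\mid\langle ?v,q\rangle$, with $lp$ a link pattern, $P$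 a graph pattern, $U$ a finite set of URIs, $V$ a finite set of variables. $\mathrm{dataset}_W(U)$ is the dataset with default graph $\bigcup_{u\in U\cap\mathrm{dom}(adoc)}\mathrm{data}(adoc(u))$ and named graphs $\langle u,\mathrm{data}(adoc(u))\rangle$ for $u\in U\cap\mathrm{dom}(adoc)$. For finite $S\subseteq\mathcal U$: $[\![\langle lpe,P\rangle]\!]^S_W=[\![P]\!]^{\mathfrak D}_G$ with $\mathfrak D=\mathrm{dataset}_W(\bigcup_{u\in S}[\![lpe]\!]^u_W)$ and $G$ its default graph; $[\![(\mathsf{SEED}\ U\ q)]\!]^S_W=[\![q]\!]^U_W$; $[\![(\mathsf{SEED}\ ?v\ q)]\!]^S_W=\bigcup_{u\in\mathcal U}([\![q]\!]^{\{u\}}_W\Join\{\{?v\mapsto u\}\})$; $\mathsf{UNION}$ is $\cup$; $\mathsf{AND}$ is $\Join$; $[\![\pi_Vq]\!]^S_W$ consists of the restrictions of the mappings in $[\![q]\!]^S_W$ to $V$. For $u_c\in\mathrm{dom}(adoc)$: $[\![\varepsilon]\!]^{u_c}_W=\{u_c\}$; $[\![lp]\!]^{u_c}_W$ is the set of URIs $u$ such that some edge $\langle adoc(u_c),(t,u),d'\rangle\in\mathcal G_W$ matches $lp$ in the context of $u_c$; $[\![l_1/l_2]\!]^{u_c}_W=\bigcup_{u'\in[\![l_1]\!]^{u_c}_W}[\![l_2]\!]^{u'}_W$; $[\![l_1|l_2]\!]^{u_c}_W$ is the union; $[\![l^*]\!]^{u_c}_W=\{u_c\}\cup[\![l]\!]^{u_c}_W\cup[\![l/l]\!]^{u_c}_W\cup\cdots$;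 $[\![[l]]\!]^{u_c}_W=\{u_c\}$ if $[\![l]\!]^{u_c}_W\ne\emptyset$, else $\emptyset$; $[\![\langle ?v,q\rangle]\!]^{u_c}_W=\{u\in\mathcal U\mid\mu(?v)=u\text{ for some }\mu\in[\![q]\!]^{\{u_c\}}_W\}$. If $u_c\notin\mathrm{dom}(adoc)$ then $[\![lpe]\!]^{u_c}_W=\emptyset$. **Property paths under context-based semantics.** PP expressions: $pe:=p\mid\,!(u_1|\cdots|u_k)\mid pe/pe\mid pe|pe\mid pe^*$ with $p,u_1,\dots,u_k\in\mathcal U$. A PP-pattern is $\langle\alpha,pe,\beta\rangle$ with $\alpha,\beta\in\mathcal U\cup\mathcal L\cup\mathcal V$. Put $C^W(u)=\{\langle s,p,o\rangle\in\mathrm{data}(adoc(u))\mid s=u\}$ for $u\in\mathrm{dom}(adoc)$ and $C^W(a)=\emptyset$ for every other RDF term $a$. $\mathit{terms}(W)$ is the set of all URIs, blank nodes and literals occurring in triples of $\mathrm{data}(d)$, $d\in D$. Then - $[\![\langle\alpha,p,\beta\rangle]\!]^{\mathsf{ctxt}}_W=\{\mu\mid\mathrm{dom}(\mu)=\{\alpha,\beta\}\cap\mathcal V,\ \mu[\langle\alpha,p,\beta\rangle]\in C^W(\mu[\alpha])\}$; - $[\![\langle\alpha,!(u_1|\cdots|u_k),\beta\rangle]\!]^{\mathsf{ctxt}}_W=\{\mu\mid\mathrm{dom}(\mu)=\{\alpha,\beta\}\cap\mathcal V,\ \exists p\notin\{u_1,\dots,u_k\}:\mu[\langle\alpha,p,\beta\rangle]\in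 C^W(\mu[\alpha])\}$; - $[\![\langle\alpha,pe_1/pe_2,\beta\rangle]\!]^{\mathsf{ctxt}}_W=\pi_{\{\alpha,\beta\}\cap\mathcal V}([\![\langle\alpha,pe_1,?v\rangle]\!]^{\mathsf{ctxt}}_W\Join[\![\langle ?v,pe_2,\beta\rangle]\!]^{\mathsf{ctxt}}_W)$ with $?v$ fresh ($\pi_X$ restricts mappings to $X$); - $|$ is union; - $[\![\langle\alpha,pe^*,\beta\rangle]\!]^{\mathsf{ctxt}}_W=\{\mu\mid\mathrm{dom}(\mu)=\{\alpha,\beta\}\cap\mathcal V,\ \mu[\alpha]=\mu[\beta]\in\mathit{terms}(W)\}\cup[\![\langle\alpha,pe,\beta\rangle]\!]^{\mathsf{ctxt}}_W\cup[\![\langle\alpha,pe/pe,\beta\rangle]\!]^{\mathsf{ctxt}}_W\cup\cdots$. *)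

theory Defs
  imports Main "HOL-Library.FSet" "HOL-Library.Infinite_Typeclass"
begin

section \<open>Data model\<close>

text \<open>
  The pairwise disjoint sets of URIs, blank nodes, literals, variables and documents are the
  types \<open>'u\<close>, \<open>'b\<close>, \<open>'l\<close>, \<open>'v\<close> and \<open>'d\<close>; unions of them are tagged by datatype constructors.
  That they are infinite is imposed by sort constraints in the theorem.
\<close>

datatype ('u, 'b, 'l) rdf_term = URI 'u | BNode 'b | Literal 'l

type_synonym ('u, 'b, 'l) triple =
  "('u, 'b, 'l) rdf_term \<times> ('u, 'b, 'l) rdf_term \<times> ('u, 'b, 'l) rdf_term"

definition rdf_triples :: "('u, 'b, 'l) triple set" where
  "rdf_triples = (range URI \<union> range BNode) \<times> range URI \<times> UNIV"

definition triple_terms :: "('u, 'b, 'l) triple \<Rightarrow> ('u, 'b, 'l) rdf_term set" where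
  "triple_terms t = (case t of (s, p, ob) \<Rightarrow> {s, p, ob})"

definition uris :: "('u, 'b, 'l) triple \<Rightarrow> 'u set" where
  "uris t = {u. URI u \<in> triple_terms t}"

definition bnodes :: "('u, 'b, 'l) triple set \<Rightarrow> 'b set" where
  "bnodes G = {b. \<exists>t\<in>G. BNode b \<in> triple_terms t}"

definition valid_data :: "('d \<Rightarrow> ('u, 'b, 'l) triple set) \<Rightarrow> bool" where
  "valid_data data \<longleftrightarrow>
     (\<forall>d. finite (data d) \<and> data d \<subseteq> rdf_triples) \<and>
     (\<forall>d d'. d \<noteq> d' \<longrightarrow> bnodes (data d) \<inter> bnodes (data d') = {})"

record ('u, 'd) web =
  docs :: "'d set"
  adoc :: "'u \<rightharpoonup> 'd"

definition valid_web :: "('u, 'd) web \<Rightarrow> bool" where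
  "valid_web W \<longleftrightarrow> finite (docs W) \<and> ran (adoc W) = docs W"

definition link_graph ::
  "('d \<Rightarrow> ('u, 'b, 'l) triple set) \<Rightarrow> ('u, 'd) web \<Rightarrow>
   ('d \<times> (('u, 'b, 'l) triple \<times> 'u) \<times> 'd) set" where
  "link_graph data W =
     {(d, (t, u), d'). d \<in> docs W \<and> t \<in> data d \<and> u \<in> uris t \<and> adoc W u = Some d'}"

definition web_terms ::
  "('d \<Rightarrow> ('u, 'b, 'l) triple set) \<Rightarrow> ('u, 'd) web \<Rightarrow> ('u, 'b, 'l) rdf_term set" where
  "web_terms data W = (\<Union>d\<in>docs W. \<Union>t\<in>data d. triple_terms t)"


section \<open>Solution mappings\<close>

text \<open>
  \<open>('u, 'l) const\<close> is the union of URIs and literals; for a set of constants \<open>'c\<close>,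
  \<open>('c, 'v) pos\<close> is its union with the variables.
\<close>

datatype ('u, 'l) const = CUri 'u | CLit 'l

datatype ('c, 'v) pos = Const 'c | Var 'v

type_synonym ('u, 'l, 'v) pat_term = "(('u, 'l) const, 'v) pos"

fun term_of_const :: "('u, 'l) const \<Rightarrow> ('u, 'b, 'l) rdf_term" where
  "term_of_const (CUri u) = URI u"
| "term_of_const (CLit l) = Literal l"

fun pos_vars :: "('c, 'v) pos \<Rightarrow> 'v set" where
  "pos_vars (Const c) = {}"
| "pos_vars (Var v) = {v}"

text \<open>
  Finiteness of the domains is not part of the type; all mappings produced by the semantics
  below have finite domain.
\<close>

type_synonym ('u, 'b, 'l, 'v) smap = "'v \<rightharpoonup> ('u, 'b, 'l) rdf_term"

text \<open>
  \<open>subst \<mu> \<alpha>\<close> is \<open>\<mu>[\<alpha>]\<close>. The case \<open>\<mu>[\<alpha>] = \<alpha>\<close> of a variable outside the domain, which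
  is not an RDF term, is rendered as \<^const>\<open>None\<close>.
\<close>

fun subst :: "('u, 'b, 'l, 'v) smap \<Rightarrow> ('u, 'l, 'v) pat_term \<Rightarrow> ('u, 'b, 'l) rdf_term option" where
  "subst \<mu> (Const c) = Some (term_of_const c)"
| "subst \<mu> (Var v) = \<mu> v"

definition compatible :: "('v \<rightharpoonup> 't) \<Rightarrow> ('v \<rightharpoonup> 't) \<Rightarrow> bool" where
  "compatible \<mu> \<mu>' \<longleftrightarrow> (\<forall>v \<in> dom \<mu> \<inter> dom \<mu>'. \<mu> v = \<mu>' v)"

definition join :: "('v \<rightharpoonup> 't) set \<Rightarrow> ('v \<rightharpoonup> 't) set \<Rightarrow> ('v \<rightharpoonup> 't) set" where
  "join \<Omega>1 \<Omega>2 = {\<mu>1 ++ \<mu>2 | \<mu>1 \<mu>2. \<mu>1 \<in> \<Omega>1 \<and> \<mu>2 \<in> \<Omega>2 \<and> compatible \<mu>1 \<mu>2}"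

definition proj :: "'v set \<Rightarrow> ('v \<rightharpoonup> 't) set \<Rightarrow> ('v \<rightharpoonup> 't) set" where
  "proj X \<Omega> = (\<lambda>\<mu>. \<mu> |` X) ` \<Omega>"


section \<open>SPARQL graph patterns\<close>

type_synonym ('u, 'l, 'v) triple_pattern =
  "('u, 'l, 'v) pat_term \<times> ('u, 'v) pos \<times> ('u, 'l, 'v) pat_term"

datatype ('u, 'l, 'v) condition =
    Bound 'v
  | EqConst 'v "('u, 'l) const"
  | EqVar 'v 'v
  | CNot "('u, 'l, 'v) condition"
  | CAnd "('u, 'l, 'v) condition" "('u, 'l, 'v) condition"
  | COr "('u, 'l, 'v) condition" "('u, 'l, 'v) condition"

datatype ('u, 'l, 'v) pattern =
    BGP "('u, 'l, 'v) triple_pattern fset"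
  | PAnd "('u, 'l, 'v) pattern" "('u, 'l, 'v) pattern"
  | PUnion "('u, 'l, 'v) pattern" "('u, 'l, 'v) pattern"
  | POpt "('u, 'l, 'v) pattern" "('u, 'l, 'v) pattern"
  | PFilter "('u, 'l, 'v) pattern" "('u, 'l, 'v) condition"
  | PGraph "('u, 'v) pos" "('u, 'l, 'v) pattern"
  | PBind "('u, 'l, 'v) pattern" "('u, 'l, 'v) pat_term" 'v

definition tp_vars :: "('u, 'l, 'v) triple_pattern \<Rightarrow> 'v set" where
  "tp_vars tp = (case tp of (\<alpha>, c, \<beta>) \<Rightarrow> pos_vars \<alpha> \<union> pos_vars c \<union> pos_vars \<beta>)"

definition bgp_vars :: "('u, 'l, 'v) triple_pattern fset \<Rightarrow> 'v set" where
  "bgp_vars B = (\<Union>tp \<in> fset B. tp_vars tp)"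

fun cond_vars :: "('u, 'l, 'v) condition \<Rightarrow> 'v set" where
  "cond_vars (Bound x) = {x}"
| "cond_vars (EqConst x c) = {x}"
| "cond_vars (EqVar x y) = {x, y}"
| "cond_vars (CNot R) = cond_vars R"
| "cond_vars (CAnd R1 R2) = cond_vars R1 \<union> cond_vars R2"
| "cond_vars (COr R1 R2) = cond_vars R1 \<union> cond_vars R2"

fun pattern_vars :: "('u, 'l, 'v) pattern \<Rightarrow> 'v set" where
  "pattern_vars (BGP B) = bgp_vars B"
| "pattern_vars (PAnd P1 P2) = pattern_vars P1 \<union> pattern_vars P2"
| "pattern_vars (PUnion P1 P2) = pattern_vars P1 \<union> pattern_vars P2"
| "pattern_vars (POpt P1 P2) = pattern_vars P1 \<union> pattern_vars P2"
| "pattern_vars (PFilter P1 R) = pattern_vars P1 \<union> cond_vars R"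
| "pattern_vars (PGraph c P1) = pos_vars c \<union> pattern_vars P1"
| "pattern_vars (PBind P1 e v) = pattern_vars P1 \<union> pos_vars e \<union> {v}"

fun wf_pattern :: "('u, 'l, 'v) pattern \<Rightarrow> bool" where
  "wf_pattern (BGP B) \<longleftrightarrow> True"
| "wf_pattern (PAnd P1 P2) \<longleftrightarrow> wf_pattern P1 \<and> wf_pattern P2"
| "wf_pattern (PUnion P1 P2) \<longleftrightarrow> wf_pattern P1 \<and> wf_pattern P2"
| "wf_pattern (POpt P1 P2) \<longleftrightarrow> wf_pattern P1 \<and> wf_pattern P2"
| "wf_pattern (PFilter P1 R) \<longleftrightarrow> wf_pattern P1"
| "wf_pattern (PGraph c P1) \<longleftrightarrow> wf_pattern P1"
| "wf_pattern (PBind P1 e v) \<longleftrightarrow> wf_pattern P1 \<and> v \<notin> pattern_vars P1"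

record ('u, 'b, 'l) dataset =
  default_graph :: "('u, 'b, 'l) triple set"
  named_graph :: "'u \<rightharpoonup> ('u, 'b, 'l) triple set"

fun sat :: "('u, 'b, 'l, 'v) smap \<Rightarrow> ('u, 'l, 'v) condition \<Rightarrow> bool" where
  "sat \<mu> (Bound x) \<longleftrightarrow> x \<in> dom \<mu>"
| "sat \<mu> (EqConst x c) \<longleftrightarrow> \<mu> x = Some (term_of_const c)"
| "sat \<mu> (EqVar x y) \<longleftrightarrow> x \<in> dom \<mu> \<and> y \<in> dom \<mu> \<and> \<mu> x = \<mu> y"
| "sat \<mu> (CNot R) \<longleftrightarrow> \<not> sat \<mu> R"
| "sat \<mu> (CAnd R1 R2) \<longleftrightarrow> sat \<mu> R1 \<and> sat \<mu> R2"
| "sat \<mu> (COr R1 R2) \<longleftrightarrow> sat \<mu> R1 \<or> sat \<mu> R2"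

text \<open>\<open>tp_holds \<mu> tp G\<close> says that \<open>\<mu>[tp]\<close> is a triple of \<open>G\<close>.\<close>

fun tp_holds ::
  "('u, 'b, 'l, 'v) smap \<Rightarrow> ('u, 'l, 'v) triple_pattern \<Rightarrow> ('u, 'b, 'l) triple set \<Rightarrow> bool" where
  "tp_holds \<mu> (\<alpha>, c, \<beta>) G \<longleftrightarrow>
     (\<exists>s p ob. subst \<mu> \<alpha> = Some s \<and> subst \<mu> (map_pos CUri id c) = Some p \<and>
        subst \<mu> \<beta> = Some ob \<and> (s, p, ob) \<in> G)"

fun eval_pattern ::
  "('u, 'b, 'l) dataset \<Rightarrow> ('u, 'b, 'l) triple set \<Rightarrow> ('u, 'l, 'v) pattern \<Rightarrow>
   ('u, 'b, 'l, 'v) smap set" where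
  "eval_pattern DS G (BGP B) = {\<mu>. dom \<mu> = bgp_vars B \<and> (\<forall>tp \<in> fset B. tp_holds \<mu> tp G)}"
| "eval_pattern DS G (PAnd P1 P2) = join (eval_pattern DS G P1) (eval_pattern DS G P2)"
| "eval_pattern DS G (PUnion P1 P2) = eval_pattern DS G P1 \<union> eval_pattern DS G P2"
| "eval_pattern DS G (POpt P1 P2) =
     join (eval_pattern DS G P1) (eval_pattern DS G P2) \<union>
     {\<mu> \<in> eval_pattern DS G P1. \<not> (\<exists>\<mu>' \<in> eval_pattern DS G P2. compatible \<mu> \<mu>')}"
| "eval_pattern DS G (PFilter P1 R) = {\<mu> \<in> eval_pattern DS G P1. sat \<mu> R}"
| "eval_pattern DS G (PGraph (Const u) P1) =
     eval_pattern DS (case named_graph DS u of None \<Rightarrow> {} | Some Gu \<Rightarrow> Gu) P1"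
| "eval_pattern DS G (PGraph (Var x) P1) =
     (\<Union>u \<in> dom (named_graph DS).
        join (eval_pattern DS (the (named_graph DS u)) P1) {[x \<mapsto> URI u]})"
| "eval_pattern DS G (PBind P1 e v) =
     (\<lambda>\<mu>. case subst \<mu> e of None \<Rightarrow> \<mu> | Some t \<Rightarrow> \<mu>(v \<mapsto> t)) ` eval_pattern DS G P1"


section \<open>LDQL\<close>

text \<open>In link patterns, \<open>Wild\<close> and \<open>Here\<close> stand for the symbols \<open>_\<close> and \<open>+\<close>.\<close>

datatype 'c lpos = Wild | Here | Is 'c

type_synonym ('u, 'l) link_pattern = "'u lpos \<times> 'u lpos \<times> ('u, 'l) const lpos"

fun pos_matches :: "'u \<Rightarrow> ('u, 'b, 'l) rdf_term \<Rightarrow> ('u, 'l) const lpos \<Rightarrow> bool" where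
  "pos_matches uc x Here \<longleftrightarrow> x = URI uc"
| "pos_matches uc x (Is c) \<longleftrightarrow> x = term_of_const c"
| "pos_matches uc x Wild \<longleftrightarrow> True"

fun edge_matches ::
  "'u \<Rightarrow> ('u, 'b, 'l) triple \<times> 'u \<Rightarrow> ('u, 'l) link_pattern \<Rightarrow> bool" where
  "edge_matches uc ((x1, x2, x3), u) (y1, y2, y3) \<longleftrightarrow>
     (y1 = Wild \<and> x1 = URI u \<or> y2 = Wild \<and> x2 = URI u \<or> y3 = Wild \<and> x3 = URI u) \<and>
     pos_matches uc x1 (map_lpos CUri y1) \<and>
     pos_matches uc x2 (map_lpos CUri y2) \<and>
     pos_matches uc x3 y3"

datatype ('u, 'l, 'v) query =
    QBasic "('u, 'l, 'v) lpe" "('u, 'l, 'v) pattern"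
  | QSeed "'u fset" "('u, 'l, 'v) query"
  | QSeedVar 'v "('u, 'l, 'v) query"
  | QAnd "('u, 'l, 'v) query" "('u, 'l, 'v) query"
  | QUnion "('u, 'l, 'v) query" "('u, 'l, 'v) query"
  | QProj "'v fset" "('u, 'l, 'v) query"
and ('u, 'l, 'v) lpe =
    LEps
  | LLink "('u, 'l) link_pattern"
  | LSeq "('u, 'l, 'v) lpe" "('u, 'l, 'v) lpe"
  | LAlt "('u, 'l, 'v) lpe" "('u, 'l, 'v) lpe"
  | LStar "('u, 'l, 'v) lpe"
  | LTest "('u, 'l, 'v) lpe"
  | LQuery 'v "('u, 'l, 'v) query"

primrec wf_query :: "('u, 'l, 'v) query \<Rightarrow> bool"
  and wf_lpe :: "('u, 'l, 'v) lpe \<Rightarrow> bool" where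
  "wf_query (QBasic l P) \<longleftrightarrow> wf_lpe l \<and> wf_pattern P"
| "wf_query (QSeed U q) \<longleftrightarrow> wf_query q"
| "wf_query (QSeedVar v q) \<longleftrightarrow> wf_query q"
| "wf_query (QAnd q1 q2) \<longleftrightarrow> wf_query q1 \<and> wf_query q2"
| "wf_query (QUnion q1 q2) \<longleftrightarrow> wf_query q1 \<and> wf_query q2"
| "wf_query (QProj V q) \<longleftrightarrow> wf_query q"
| "wf_lpe LEps \<longleftrightarrow> True"
| "wf_lpe (LLink lp) \<longleftrightarrow> True"
| "wf_lpe (LSeq l1 l2) \<longleftrightarrow> wf_lpe l1 \<and> wf_lpe l2"
| "wf_lpe (LAlt l1 l2) \<longleftrightarrow> wf_lpe l1 \<and> wf_lpe l2"
| "wf_lpe (LStar l) \<longleftrightarrow> wf_lpe l"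
| "wf_lpe (LTest l) \<longleftrightarrow> wf_lpe l"
| "wf_lpe (LQuery v q) \<longleftrightarrow> wf_query q"

definition web_dataset ::
  "('d \<Rightarrow> ('u, 'b, 'l) triple set) \<Rightarrow> ('u, 'd) web \<Rightarrow> 'u set \<Rightarrow> ('u, 'b, 'l) dataset" where
  "web_dataset data W U =
     \<lparr>default_graph = (\<Union>u \<in> U \<inter> dom (adoc W). data (the (adoc W u))),
      named_graph = (\<lambda>u. if u \<in> U then map_option data (adoc W u) else None)\<rparr>"

text \<open>\<open>lpe_iter l n\<close> is \<open>l/\<dots>/l\<close> with \<open>n + 1\<close> occurrences of \<open>l\<close>.\<close>

primrec lpe_iter :: "('u, 'l, 'v) lpe \<Rightarrow> nat \<Rightarrow> ('u, 'l, 'v) lpe" where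
  "lpe_iter l 0 = l"
| "lpe_iter l (Suc n) = LSeq l (lpe_iter l n)"

text \<open>
  The iterates of \<open>l\<close> are larger than \<open>LStar l\<close> but have smaller star height, so the
  semantics is well-founded for the lexicographic order on star height and size.
\<close>

primrec query_height :: "('u, 'l, 'v) query \<Rightarrow> nat"
  and lpe_height :: "('u, 'l, 'v) lpe \<Rightarrow> nat" where
  "query_height (QBasic l P) = lpe_height l"
| "query_height (QSeed U q) = query_height q"
| "query_height (QSeedVar v q) = query_height q"
| "query_height (QAnd q1 q2) = max (query_height q1) (query_height q2)"
| "query_height (QUnion q1 q2) = max (query_height q1) (query_height q2)"
| "query_height (QProj V q) = query_height q"
| "lpe_height LEps = 0"
| "lpe_height (LLink lp) = 0"
| "lpe_height (LSeq l1 l2) = max (lpe_height l1) (lpe_height l2)"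
| "lpe_height (LAlt l1 l2) = max (lpe_height l1) (lpe_height l2)"
| "lpe_height (LStar l) = Suc (lpe_height l)"
| "lpe_height (LTest l) = lpe_height l"
| "lpe_height (LQuery v q) = query_height q"

lemma lpe_height_iter [simp]: "lpe_height (lpe_iter l n) = lpe_height l"
  by (induction n) auto

function (sequential) eval_query ::
    "('d \<Rightarrow> ('u, 'b, 'l) triple set) \<Rightarrow> ('u, 'd) web \<Rightarrow> ('u, 'l, 'v) query \<Rightarrow> 'u set \<Rightarrow>
     ('u, 'b, 'l, 'v) smap set"
  and eval_lpe ::
    "('d \<Rightarrow> ('u, 'b, 'l) triple set) \<Rightarrow> ('u, 'd) web \<Rightarrow> ('u, 'l, 'v) lpe \<Rightarrow> 'u \<Rightarrow> 'u set" where
  "eval_query data W (QBasic l P) S =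
     (let DS = web_dataset data W (\<Union>u\<in>S. eval_lpe data W l u)
      in eval_pattern DS (default_graph DS) P)"
| "eval_query data W (QSeed U q) S = eval_query data W q (fset U)"
| "eval_query data W (QSeedVar v q) S = (\<Union>u. join (eval_query data W q {u}) {[v \<mapsto> URI u]})"
| "eval_query data W (QAnd q1 q2) S = join (eval_query data W q1 S) (eval_query data W q2 S)"
| "eval_query data W (QUnion q1 q2) S = eval_query data W q1 S \<union> eval_query data W q2 S"
| "eval_query data W (QProj V q) S = proj (fset V) (eval_query data W q S)"
| "eval_lpe data W LEps uc = (if uc \<in> dom (adoc W) then {uc} else {})"
| "eval_lpe data W (LLink lp) uc =
     {u. \<exists>d t d'. adoc W uc = Some d \<and> (d, (t, u), d') \<in> link_graph data W \<and>
           edge_matches uc (t, u) lp}"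
| "eval_lpe data W (LSeq l1 l2) uc =
     (if uc \<in> dom (adoc W) then (\<Union>u' \<in> eval_lpe data W l1 uc. eval_lpe data W l2 u') else {})"
| "eval_lpe data W (LAlt l1 l2) uc =
     (if uc \<in> dom (adoc W) then eval_lpe data W l1 uc \<union> eval_lpe data W l2 uc else {})"
| "eval_lpe data W (LStar l) uc =
     (if uc \<in> dom (adoc W) then {uc} \<union> (\<Union>n. eval_lpe data W (lpe_iter l n) uc) else {})"
| "eval_lpe data W (LTest l) uc =
     (if uc \<in> dom (adoc W) \<and> eval_lpe data W l uc \<noteq> {} then {uc} else {})"
| "eval_lpe data W (LQuery v q) uc =
     (if uc \<in> dom (adoc W) then {u. \<exists>\<mu> \<in> eval_query data W q {uc}. \<mu> v = Some (URI u)} else {})"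
  by pat_completeness auto
termination
  by (relation "measures
      [\<lambda>x. case x of Inl (_, _, q, _) \<Rightarrow> query_height q | Inr (_, _, l, _) \<Rightarrow> lpe_height l,
       \<lambda>x. case x of Inl (_, _, q, _) \<Rightarrow> size q | Inr (_, _, l, _) \<Rightarrow> size l]")
    (auto simp: less_max_iff_disj)


section \<open>Property paths under context-based semantics\<close>

datatype 'u pp =
    PPUri 'u
  | PPNeg "'u list"
  | PPSeq "'u pp" "'u pp"
  | PPAlt "'u pp" "'u pp"
  | PPStar "'u pp"

text \<open>\<open>ctxt_data data W a\<close> is the set of triples \<open>C\<^sup>W(a)\<close>.\<close>

fun ctxt_data ::
  "('d \<Rightarrow> ('u, 'b, 'l) triple set) \<Rightarrow> ('u, 'd) web \<Rightarrow> ('u, 'b, 'l) rdf_term \<Rightarrow>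
   ('u, 'b, 'l) triple set" where
  "ctxt_data data W (URI u) =
     (case adoc W u of None \<Rightarrow> {} | Some d \<Rightarrow> {(s, p, ob) \<in> data d. s = URI u})"
| "ctxt_data data W (BNode b) = {}"
| "ctxt_data data W (Literal l) = {}"

text \<open>\<open>ctxt_holds data W \<mu> \<alpha> p \<beta>\<close> says that \<open>\<mu>[\<langle>\<alpha>, p, \<beta>\<rangle>] \<in> C\<^sup>W(\<mu>[\<alpha>])\<close>.\<close>

definition ctxt_holds ::
  "('d \<Rightarrow> ('u, 'b, 'l) triple set) \<Rightarrow> ('u, 'd) web \<Rightarrow> ('u, 'b, 'l, 'v) smap \<Rightarrow>
   ('u, 'l, 'v) pat_term \<Rightarrow> 'u \<Rightarrow> ('u, 'l, 'v) pat_term \<Rightarrow> bool" where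
  "ctxt_holds data W \<mu> \<alpha> p \<beta> \<longleftrightarrow>
     (\<exists>s ob. subst \<mu> \<alpha> = Some s \<and> subst \<mu> \<beta> = Some ob \<and>
        (s, URI p, ob) \<in> ctxt_data data W s)"

text \<open>
  Property path expressions contain no variables, so a variable is fresh for
  \<open>\<langle>\<alpha>, pe, \<beta>\<rangle>\<close> as soon as it differs from \<open>\<alpha>\<close> and \<open>\<beta>\<close>.
\<close>

definition fresh_var :: "('c, 'v) pos \<Rightarrow> ('c, 'v) pos \<Rightarrow> 'v" where
  "fresh_var \<alpha> \<beta> = (SOME v. v \<notin> pos_vars \<alpha> \<union> pos_vars \<beta>)"

lemma fresh_var:
  fixes \<alpha> \<beta> :: "('c, 'v::infinite) pos"
  shows "fresh_var \<alpha> \<beta> \<notin> pos_vars \<alpha> \<union> pos_vars \<beta>"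
proof -
  have "finite (pos_vars \<alpha> \<union> pos_vars \<beta>)"
    by (cases \<alpha>; cases \<beta>) auto
  then have "\<exists>v. v \<notin> pos_vars \<alpha> \<union> pos_vars \<beta>"
    using ex_new_if_finite infinite_UNIV by blast
  then show ?thesis
    unfolding fresh_var_def by (rule someI_ex)
qed

text \<open>\<open>pp_iter pe n\<close> is \<open>pe/\<dots>/pe\<close> with \<open>n + 1\<close> occurrences of \<open>pe\<close>.\<close>

primrec pp_iter :: "'u pp \<Rightarrow> nat \<Rightarrow> 'u pp" where
  "pp_iter pe 0 = pe"
| "pp_iter pe (Suc n) = PPSeq pe (pp_iter pe n)"

primrec pp_height :: "'u pp \<Rightarrow> nat" where
  "pp_height (PPUri p) = 0"
| "pp_height (PPNeg us) = 0"
| "pp_height (PPSeq pe1 pe2) = max (pp_height pe1) (pp_height pe2)"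
| "pp_height (PPAlt pe1 pe2) = max (pp_height pe1) (pp_height pe2)"
| "pp_height (PPStar pe) = Suc (pp_height pe)"

lemma pp_height_iter [simp]: "pp_height (pp_iter pe n) = pp_height pe"
  by (induction n) auto

function (sequential) eval_pp ::
  "('d \<Rightarrow> ('u, 'b, 'l) triple set) \<Rightarrow> ('u, 'd) web \<Rightarrow>
   ('u, 'l, 'v) pat_term \<Rightarrow> 'u pp \<Rightarrow> ('u, 'l, 'v) pat_term \<Rightarrow> ('u, 'b, 'l, 'v) smap set" where
  "eval_pp data W \<alpha> (PPUri p) \<beta> =
     {\<mu>. dom \<mu> = pos_vars \<alpha> \<union> pos_vars \<beta> \<and> ctxt_holds data W \<mu> \<alpha> p \<beta>}"
| "eval_pp data W \<alpha> (PPNeg us) \<beta> =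
     {\<mu>. dom \<mu> = pos_vars \<alpha> \<union> pos_vars \<beta> \<and> (\<exists>p. p \<notin> set us \<and> ctxt_holds data W \<mu> \<alpha> p \<beta>)}"
| "eval_pp data W \<alpha> (PPSeq pe1 pe2) \<beta> =
     (let v = Var (fresh_var \<alpha> \<beta>)
      in proj (pos_vars \<alpha> \<union> pos_vars \<beta>)
           (join (eval_pp data W \<alpha> pe1 v) (eval_pp data W v pe2 \<beta>)))"
| "eval_pp data W \<alpha> (PPAlt pe1 pe2) \<beta> = eval_pp data W \<alpha> pe1 \<beta> \<union> eval_pp data W \<alpha> pe2 \<beta>"
| "eval_pp data W \<alpha> (PPStar pe) \<beta> =
     {\<mu>. dom \<mu> = pos_vars \<alpha> \<union> pos_vars \<beta> \<and>
         (\<exists>t \<in> web_terms data W. subst \<mu> \<alpha> = Some t \<and> subst \<mu> \<beta> = Some t)} \<union>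
     (\<Union>n. eval_pp data W \<alpha> (pp_iter pe n) \<beta>)"
  by pat_completeness auto
termination
  by (relation "measures
      [\<lambda>(_, _, _, pe, _). pp_height pe, \<lambda>(_, _, _, pe, _). size pe]")
    (auto simp: less_max_iff_disj)

end

theory Submission
  imports Defs
begin

text \<open>
  Under context-based semantics a property path denotes a binary relation on the terms of the
  Web, with composition, union and reflexive transitive closure. For two distinct variables
  each of these operations is matched by an LDQL query: the elementary steps by seeding at
  every URI and evaluating a graph pattern over its own document, and composition by a join on
  a fresh variable followed by a projection. The difficulty is the star, since LDQL iterates
  only inside link path expressions, which see only URIs, whereas a path may also relate blank
  nodes and literals. But any pair with different components in the relation of a path starts
  at a URI that has a document, so in a chain all steps except the last one are navigation
  between such URIs.
  Arbitrary endpoints are reduced to variables by composing with partial identities.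
\<close>

section \<open>Path expressions as binary relations on terms\<close>

text \<open>Passes from relations to solution mappings uniformly for all kinds of endpoints: a
  constant endpoint selects pairs without contributing to the domain, and two equal variables select
  the diagonal.\<close>

definition sols ::
  "('u, 'l, 'v) pat_term \<Rightarrow> ('u, 'l, 'v) pat_term \<Rightarrow> ('u, 'b, 'l) rdf_term rel \<Rightarrow>
   ('u, 'b, 'l, 'v) smap set" where
  "sols \<alpha> \<beta> R = {\<mu>. dom \<mu> = pos_vars \<alpha> \<union> pos_vars \<beta> \<and>
     (\<exists>s t. subst \<mu> \<alpha> = Some s \<and> subst \<mu> \<beta> = Some t \<and> (s, t) \<in> R)}"

text \<open>The star uses \<open>trancl\<close> rather than \<open>rtrancl\<close>, since
  reflexivity holds only on the terms of the Web and not on the whole type of terms.\<close>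

primrec pp_rel ::
  "('d \<Rightarrow> ('u, 'b, 'l) triple set) \<Rightarrow> ('u, 'd) web \<Rightarrow> 'u pp \<Rightarrow> ('u, 'b, 'l) rdf_term rel" where
  "pp_rel data W (PPUri p) = {(s, t). (s, URI p, t) \<in> ctxt_data data W s}"
| "pp_rel data W (PPNeg us) = {(s, t). \<exists>p. p \<notin> set us \<and> (s, URI p, t) \<in> ctxt_data data W s}"
| "pp_rel data W (PPSeq pe1 pe2) = pp_rel data W pe1 O pp_rel data W pe2"
| "pp_rel data W (PPAlt pe1 pe2) = pp_rel data W pe1 \<union> pp_rel data W pe2"
| "pp_rel data W (PPStar pe) = Id_on (web_terms data W) \<union> (pp_rel data W pe)\<^sup>+"

lemma sols_Un: "sols \<alpha> \<beta> (R \<union> R') = sols \<alpha> \<beta> R \<union> sols \<alpha> \<beta> R'"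
  by (auto simp: sols_def)

lemma sols_UN: "sols \<alpha> \<beta> (\<Union>i\<in>I. R i) = (\<Union>i\<in>I. sols \<alpha> \<beta> (R i))"
  by (auto simp: sols_def)

lemma sols_converse: "sols \<alpha> \<beta> (R\<inverse>) = sols \<beta> \<alpha> R"
  by (auto simp: sols_def)

lemma sols_Var_Var:
  assumes "x \<noteq> y"
  shows "sols (Var x) (Var y) R = {[x \<mapsto> s, y \<mapsto> t] | s t. (s, t) \<in> R}"
proof -
  have "\<mu> = [x \<mapsto> s, y \<mapsto> t]"
    if "dom \<mu> = {x, y}" "\<mu> x = Some s" "\<mu> y = Some t" for \<mu> s t
  proof
    fix v show "\<mu> v = [x \<mapsto> s, y \<mapsto> t] v"
      using that by (cases "v \<in> dom \<mu>") auto
  qed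
  then show ?thesis
    using assms by (fastforce simp: sols_def)
qed

lemma compatibleD: "compatible \<mu> \<mu>' \<Longrightarrow> \<mu> v = Some t \<Longrightarrow> \<mu>' v = Some t' \<Longrightarrow> t' = t"
  unfolding compatible_def by (metis IntI domI option.inject)

lemma compatible_map_add: "compatible \<mu> \<mu>' \<Longrightarrow> \<mu> v = Some t \<Longrightarrow> (\<mu> ++ \<mu>') v = Some t"
  by (cases "\<mu>' v") (auto simp: map_add_Some_iff dest: compatibleD)

text \<open>Compatibility identifies the two values at \<open>v\<close>, which is the middle term of
  the composition; as \<open>v\<close> is fresh, the projection forgets exactly this term. The
  endpoints may be the same variable, and compatibility then forces the outer terms to agree as
  well.\<close>

lemma proj_join_sols:
  assumes v: "v \<notin> pos_vars \<alpha> \<union> pos_vars \<beta>"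
  shows "proj (pos_vars \<alpha> \<union> pos_vars \<beta>) (join (sols \<alpha> (Var v) R1) (sols (Var v) \<beta> R2)) =
    sols \<alpha> \<beta> (R1 O R2)" (is "?L = ?R")
proof
  show "?L \<subseteq> ?R"
  proof
    fix \<mu> assume "\<mu> \<in> ?L"
    then obtain \<mu>1 \<mu>2 where \<mu>: "\<mu> = (\<mu>1 ++ \<mu>2) |` (pos_vars \<alpha> \<union> pos_vars \<beta>)"
      and 1: "\<mu>1 \<in> sols \<alpha> (Var v) R1" and 2: "\<mu>2 \<in> sols (Var v) \<beta> R2"
      and c: "compatible \<mu>1 \<mu>2"
      by (auto simp: proj_def join_def)
    from 1 obtain s t where s: "dom \<mu>1 = pos_vars \<alpha> \<union> {v}" "subst \<mu>1 \<alpha> = Some s"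
      "\<mu>1 v = Some t" "(s, t) \<in> R1" by (auto simp: sols_def)
    from 2 obtain t' r where r: "dom \<mu>2 = {v} \<union> pos_vars \<beta>" "subst \<mu>2 \<beta> = Some r"
      "\<mu>2 v = Some t'" "(t', r) \<in> R2" by (auto simp: sols_def)
    have "t' = t" using c s(3) r(3) by (rule compatibleD)
    moreover have "subst \<mu> \<alpha> = Some s"
      using c s(2) by (cases \<alpha>) (auto simp: \<mu> compatible_map_add)
    moreover have "subst \<mu> \<beta> = Some r"
      using r(2) by (cases \<beta>) (auto simp: \<mu> map_add_def)
    moreover have "dom \<mu> = pos_vars \<alpha> \<union> pos_vars \<beta>"
      using s(1) r(1) by (auto simp: \<mu>)
    ultimately show "\<mu> \<in> ?R" using s(4) r(4) by (auto simp: sols_def)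
  qed
next
  show "?R \<subseteq> ?L"
  proof
    fix \<mu> assume "\<mu> \<in> ?R"
    then obtain s t r where d: "dom \<mu> = pos_vars \<alpha> \<union> pos_vars \<beta>" and s: "subst \<mu> \<alpha> = Some s"
      and r: "subst \<mu> \<beta> = Some r" and R: "(s, t) \<in> R1" "(t, r) \<in> R2"
      by (auto simp: sols_def)
    \<comment> \<open>The mapping is split along its two endpoints, and both halves are extended by
      the middle term.\<close>
    let ?\<mu>1 = "(\<mu> |` pos_vars \<alpha>)(v \<mapsto> t)" and ?\<mu>2 = "(\<mu> |` pos_vars \<beta>)(v \<mapsto> t)"
    have "?\<mu>1 \<in> sols \<alpha> (Var v) R1"
      using d s R(1) v by (cases \<alpha>) (auto simp: sols_def)
    moreover have "?\<mu>2 \<in> sols (Var v) \<beta> R2"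
      using d r R(2) v by (cases \<beta>) (auto simp: sols_def)
    moreover have "compatible ?\<mu>1 ?\<mu>2"
      by (auto simp: compatible_def restrict_map_def split: if_splits)
    moreover have "\<mu> = (?\<mu>1 ++ ?\<mu>2) |` (pos_vars \<alpha> \<union> pos_vars \<beta>)"
    proof
      fix w show "\<mu> w = ((?\<mu>1 ++ ?\<mu>2) |` (pos_vars \<alpha> \<union> pos_vars \<beta>)) w"
        using d v by (cases "w \<in> dom \<mu>") (auto simp: restrict_map_def map_add_def split: option.splits)
    qed
    ultimately show "\<mu> \<in> ?L"
      unfolding proj_def join_def by blast
  qed
qed

text \<open>This and \<open>join_singleton_unbound\<close> are the two effects of
  \<open>SEED ?x\<close>: if \<open>x\<close> is already bound, seeding selects the mappings whose
  value at \<open>x\<close> is the seed; otherwise it records the seed.\<close>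

lemma join_singleton_bound:
  assumes "\<And>\<mu>. \<mu> \<in> \<Omega> \<Longrightarrow> x \<in> dom \<mu>"
  shows "join \<Omega> {[x \<mapsto> t]} = {\<mu> \<in> \<Omega>. \<mu> x = Some t}"
proof -
  have "compatible \<mu> [x \<mapsto> t] \<longleftrightarrow> \<mu> x = Some t" if "\<mu> \<in> \<Omega>" for \<mu>
    using assms[OF that] by (auto simp: compatible_def)
  moreover have "\<mu> ++ [x \<mapsto> t] = \<mu>" if "\<mu> x = Some t" for \<mu>
    using that by (auto simp: fun_eq_iff)
  ultimately have "\<mu> \<in> join \<Omega> {[x \<mapsto> t]} \<longleftrightarrow> \<mu> \<in> \<Omega> \<and> \<mu> x = Some t" for \<mu>
    unfolding join_def mem_Collect_eq singleton_iff by metis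
  then show ?thesis by blast
qed

lemma join_singleton_unbound:
  assumes "\<And>\<mu>. \<mu> \<in> \<Omega> \<Longrightarrow> x \<notin> dom \<mu>"
  shows "join \<Omega> {[x \<mapsto> t]} = (\<lambda>\<mu>. \<mu>(x \<mapsto> t)) ` \<Omega>"
proof -
  have "compatible \<mu> [x \<mapsto> t]" if "\<mu> \<in> \<Omega>" for \<mu>
    using assms[OF that] by (auto simp: compatible_def)
  then show ?thesis
    unfolding join_def by auto
qed

lemma pp_rel_iter: "pp_rel data W (pp_iter pe n) = pp_rel data W pe ^^ Suc n"
proof (induction n)
  case (Suc n)
  have "pp_rel data W (pp_iter pe (Suc n)) = pp_rel data W pe O pp_rel data W pe ^^ Suc n"
    using Suc by simp
  also have "\<dots> = pp_rel data W pe ^^ Suc (Suc n)"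
    \<comment> \<open>\<open>pp_iter\<close> grows on the left, \<open>relpow\<close> on the
      right.\<close>
    by (metis relpow.simps(2) relpow_commute)
  finally show ?case .
qed simp

lemma pp_rel_PPStar:
  "pp_rel data W (PPStar pe) =
     Id_on (web_terms data W) \<union> (\<Union>n. pp_rel data W (pp_iter pe n))"
proof -
  have "p \<in> (pp_rel data W pe)\<^sup>+ \<longleftrightarrow> (\<exists>n. p \<in> pp_rel data W pe ^^ Suc n)" for p
    unfolding trancl_power gr0_conv_Suc by blast
  then have "(pp_rel data W pe)\<^sup>+ = (\<Union>n. pp_rel data W pe ^^ Suc n)"
    by blast
  then show ?thesis
    by (simp only: pp_rel.simps pp_rel_iter)
qed

text \<open>Induction along the recursion of \<open>eval_pp\<close>, which supplies a hypothesis for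
  every iterate of a star. The particular choice made by \<open>fresh_var\<close> disappears through
  \<open>proj_join_sols\<close>.\<close>

lemma eval_pp_eq_sols:
  fixes \<alpha> \<beta> :: "('u, 'l, 'v::infinite) pat_term"
  shows "eval_pp data W \<alpha> pe \<beta> = sols \<alpha> \<beta> (pp_rel data W pe)"
proof (induction data W \<alpha> pe \<beta> rule: eval_pp.induct)
  case (3 data W \<alpha> pe1 pe2 \<beta>)
  have "fresh_var \<alpha> \<beta> \<notin> pos_vars \<alpha> \<union> pos_vars \<beta>"
    by (rule fresh_var)
  then show ?case
    using 3 by (simp add: Let_def proj_join_sols)
next
  case (5 data W \<alpha> pe \<beta>)
  have "{\<mu>. dom \<mu> = pos_vars \<alpha> \<union> pos_vars \<beta> \<and>
         (\<exists>t \<in> web_terms data W. subst \<mu> \<alpha> = Some t \<and> subst \<mu> \<beta> = Some t)} =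
      sols \<alpha> \<beta> (Id_on (web_terms data W))"
    by (auto simp: sols_def)
  then show ?case
    unfolding pp_rel_PPStar sols_Un sols_UN using 5 by simp
qed (auto simp: sols_def ctxt_holds_def)

section \<open>Terms and starting points of path relations\<close>

lemma ctxt_data_E:
  assumes "(s, p, t) \<in> ctxt_data data W r"
  obtains u d where "r = URI u" "s = URI u" "adoc W u = Some d" "(URI u, p, t) \<in> data d"
  using assms by (cases r) (auto split: option.splits)

lemma web_terms_iff:
  "t \<in> web_terms data W \<longleftrightarrow> (\<exists>d\<in>docs W. \<exists>t1 t2.
     (t, t1, t2) \<in> data d \<or> (t1, t, t2) \<in> data d \<or> (t1, t2, t) \<in> data d)"
proof -
  have "t \<in> web_terms data W \<longleftrightarrow> (\<exists>d\<in>docs W. \<exists>s p r. (s, p, r) \<in> data d \<and> t \<in> {s, p, r})"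
    by (simp add: web_terms_def triple_terms_def Bex_def)
  then show ?thesis by blast
qed

text \<open>Every elementary step is a triple in the document of its subject, and that document
  belongs to the Web. Consequently, composing with the identity on the terms of the Web changes
  nothing.\<close>

lemma pp_rel_subset:
  assumes W: "valid_web W"
  shows "pp_rel data W pe \<subseteq> web_terms data W \<times> web_terms data W"
proof (induction pe)
  have *: "s \<in> web_terms data W \<and> t \<in> web_terms data W"
    if st: "(s, URI p, t) \<in> ctxt_data data W s" for s p t
  proof -
    from st obtain u d where "s = URI u" and d: "adoc W u = Some d" "(s, URI p, t) \<in> data d"
      by (metis ctxt_data_E)
    from d(1) have "d \<in> docs W" using W by (auto simp: valid_web_def ran_def)
    with d(2) show ?thesis
      unfolding web_terms_iff by blast
  qed
  {
    case (PPUri p) then show ?case using * by auto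
  next
    case (PPNeg us) then show ?case using * by auto
  next
    case (PPStar pe)
    then have "(pp_rel data W pe)\<^sup>+ \<subseteq> web_terms data W \<times> web_terms data W"
      by (rule trancl_subset_Sigma)
    then show ?case by auto
  }
qed auto

text \<open>Elementary steps start at a URI with a document because all other terms have empty
  context data. Reflexive pairs of a star are the only exception, and composition either skips them
  or keeps the starting point of a proper step.\<close>

lemma pp_rel_domain:
  assumes "(s, t) \<in> pp_rel data W pe"
  shows "s = t \<or> s \<in> URI ` dom (adoc W)"
  using assms
proof (induction pe arbitrary: s t)
  case (PPStar pe)
  have "s = t \<or> s \<in> URI ` dom (adoc W)" if "(s, t) \<in> (pp_rel data W pe)\<^sup>+"
    using that by (induction rule: trancl_induct) (use PPStar.IH in blast)+
  then show ?case
    using PPStar.prems by auto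
qed (fastforce elim: ctxt_data_E)+

section \<open>Queries that express a relation on every Web\<close>

text \<open>The result must be the same for every seed set \<open>S\<close>, not just for the empty
  one: the star places such a query inside a link path expression, where it is evaluated at
  \<open>{u}\<close>.\<close>

definition expresses ::
  "('u, 'l, 'v) query \<Rightarrow> ('u, 'l, 'v) pat_term \<Rightarrow> ('u, 'l, 'v) pat_term \<Rightarrow>
   (('d \<Rightarrow> ('u, 'b, 'l) triple set) \<Rightarrow> ('u, 'd) web \<Rightarrow> ('u, 'b, 'l) rdf_term rel) \<Rightarrow> bool" where
  "expresses q \<alpha> \<beta> R \<longleftrightarrow> wf_query q \<and>
     (\<forall>data W S. valid_data data \<longrightarrow> valid_web W \<longrightarrow>
        eval_query data W q S = sols \<alpha> \<beta> (R data W))"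

lemma expresses_comp:
  assumes "v \<notin> pos_vars \<alpha> \<union> pos_vars \<beta>" "expresses q1 \<alpha> (Var v) R1" "expresses q2 (Var v) \<beta> R2"
  shows "\<exists>q. expresses q \<alpha> \<beta> (\<lambda>data W. R1 data W O R2 data W)"
proof -
  have "finite (pos_vars \<alpha> \<union> pos_vars \<beta>)"
    by (cases \<alpha>; cases \<beta>) auto
  then obtain V where V: "fset V = pos_vars \<alpha> \<union> pos_vars \<beta>"
    by (metis Abs_fset_inverse mem_Collect_eq)
  have "expresses (QProj V (QAnd q1 q2)) \<alpha> \<beta> (\<lambda>data W. R1 data W O R2 data W)"
    using assms by (simp add: expresses_def V proj_join_sols)
  then show ?thesis ..
qed

lemma expresses_cong:
  assumes "expresses q \<alpha> \<beta> R" "\<And>data W. valid_web W \<Longrightarrow> R data W = R' data W"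
  shows "expresses q \<alpha> \<beta> R'"
  using assms by (simp add: expresses_def)

lemma expresses_Un:
  assumes "expresses q1 \<alpha> \<beta> R1" "expresses q2 \<alpha> \<beta> R2"
  shows "expresses (QUnion q1 q2) \<alpha> \<beta> (\<lambda>data W. R1 data W \<union> R2 data W)"
  using assms by (simp add: expresses_def sols_Un)

lemma expresses_converse:
  "expresses q \<alpha> \<beta> (\<lambda>data W. (R data W)\<inverse>) \<longleftrightarrow> expresses q \<beta> \<alpha> R"
  by (simp add: expresses_def sols_converse)

section \<open>Elementary steps\<close>

lemma eval_query_LEps_singleton:
  "eval_query data W (QBasic LEps P) {u} =
     (let DS = web_dataset data W (if u \<in> dom (adoc W) then {u} else {})
      in eval_pattern DS (default_graph DS) P)"
  by simp

lemma default_graph_singleton: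
  "default_graph (web_dataset data W (if u \<in> dom (adoc W) then {u} else {})) =
     (case adoc W u of None \<Rightarrow> {} | Some d \<Rightarrow> data d)"
  by (auto simp: web_dataset_def split: option.splits)

lemma ex_distinct_fresh:
  fixes A :: "'v::infinite set"
  assumes "finite A"
  obtains v where "v \<notin> A"
  using assms ex_new_if_finite infinite_UNIV by blast

lemma eval_pattern_BGP_Vars:
  "eval_pattern DS G (BGP {|(Var x, Var v, Var y)|}) =
    {\<mu>. dom \<mu> = {x, v, y} \<and>
      (\<exists>s p t. \<mu> x = Some s \<and> \<mu> v = Some p \<and> \<mu> y = Some t \<and> (s, p, t) \<in> G)}"
  by (auto simp: bgp_vars_def tp_vars_def)

text \<open>\<open>SEED ?x\<close> evaluates the pattern over the document of each URI
  \<open>u\<close>, and the join with \<open>[x \<mapsto> URI u]\<close> keeps the triples with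
  subject \<open>u\<close>; these are the context data of \<open>u\<close>. The test on the
  predicate is abstracted as \<open>Q\<close>, so that single URIs and negated sets are treated
  alike.\<close>

lemma expresses_step:
  fixes x y :: "'v::infinite"
  assumes xy: "x \<noteq> y"
    and R: "\<And>v. \<exists>C :: ('u, 'l, 'v) condition. \<forall>(\<mu> :: ('u, 'b, 'l, 'v) smap) p.
       \<mu> v = Some (URI p) \<longrightarrow> (sat \<mu> C \<longleftrightarrow> Q p)"
  shows "\<exists>q :: ('u, 'l, 'v) query. expresses q (Var x) (Var y)
    (\<lambda>(data :: 'd \<Rightarrow> ('u, 'b, 'l) triple set) W.
      {(s, t). \<exists>p. Q p \<and> (s, URI p, t) \<in> ctxt_data data W s})"
proof -
  obtain v where v: "v \<noteq> x" "v \<noteq> y"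
    using ex_distinct_fresh[of "{x, y}"] by auto
  obtain C :: "('u, 'l, 'v) condition" where
    C: "\<And>(\<mu> :: ('u, 'b, 'l, 'v) smap) p. \<mu> v = Some (URI p) \<Longrightarrow> sat \<mu> C \<longleftrightarrow> Q p"
    using R[of v] by blast
  let ?P = "PFilter (BGP {|(Var x, Var v, Var y)|}) C"
  let ?q = "QProj {|x, y|} (QSeedVar x (QBasic LEps ?P))"
  have "eval_query data W ?q S = sols (Var x) (Var y)
      {(s, t). \<exists>p. Q p \<and> (s, URI p, t) \<in> ctxt_data data W s}"
    if D: "valid_data data"
    for data :: "'d \<Rightarrow> ('u, 'b, 'l) triple set" and W S
  proof -
    let ?G = "\<lambda>u. case adoc W u of None \<Rightarrow> {} | Some d \<Rightarrow> data d"
    let ?\<Omega> = "\<lambda>u. {\<mu>. dom \<mu> = {x, v, y} \<and> sat \<mu> C \<and>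
      (\<exists>s p t. \<mu> x = Some s \<and> \<mu> v = Some p \<and> \<mu> y = Some t \<and> (s, p, t) \<in> ?G u)}"
    have e: "eval_query data W (QBasic LEps ?P) {u} = ?\<Omega> u" for u
      unfolding eval_query_LEps_singleton Let_def
      by (auto simp: default_graph_singleton bgp_vars_def tp_vars_def)
    have j: "join (?\<Omega> u) {[x \<mapsto> URI u]} = {\<mu> \<in> ?\<Omega> u. \<mu> x = Some (URI u)}" for u
      by (rule join_singleton_bound) auto
    have "eval_query data W ?q S = proj {x, y} (\<Union>u. {\<mu> \<in> ?\<Omega> u. \<mu> x = Some (URI u)})"
      unfolding eval_query.simps(6) eval_query.simps(3) e j by simp
    also have "\<dots> = {[x \<mapsto> s, y \<mapsto> t] | s t. \<exists>p. Q p \<and> (s, URI p, t) \<in> ctxt_data data W s}"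
      (is "?L = ?R")
    proof
      show "?L \<subseteq> ?R"
      proof
        fix \<mu>' assume "\<mu>' \<in> ?L"
        then obtain \<mu> u p t where \<mu>': "\<mu>' = \<mu> |` {x, y}" and d: "dom \<mu> = {x, v, y}"
          and C': "sat \<mu> C" and \<mu>: "\<mu> x = Some (URI u)" "\<mu> v = Some p" "\<mu> y = Some t"
          and G: "(URI u, p, t) \<in> ?G u"
          by (auto simp: proj_def)
        \<comment> \<open>The property of \<open>C\<close> concerns only predicates that are URIs;
          validity of the data provides this.\<close>
        from G have "(URI u, p, t) \<in> rdf_triples"
          using D by (auto simp: valid_data_def split: option.splits)
        then obtain p' where p': "p = URI p'" by (auto simp: rdf_triples_def)
        have "Q p'" using C C' \<mu>(2) p' by blast
        moreover have "\<mu>' = [x \<mapsto> URI u, y \<mapsto> t]"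
          using \<mu> by (auto simp: \<mu>' fun_eq_iff restrict_map_def)
        moreover have "(URI u, URI p', t) \<in> ctxt_data data W (URI u)"
          using G p' by (auto split: option.splits)
        ultimately show "\<mu>' \<in> ?R" by blast
      qed
    next
      show "?R \<subseteq> ?L"
      proof
        fix \<mu>' assume "\<mu>' \<in> ?R"
        then obtain s t p where \<mu>': "\<mu>' = [x \<mapsto> s, y \<mapsto> t]" and Q: "Q p"
          and c: "(s, URI p, t) \<in> ctxt_data data W s" by auto
        from c obtain u d where s: "s = URI u" and d: "adoc W u = Some d" "(URI u, URI p, t) \<in> data d"
          by (metis ctxt_data_E)
        let ?\<mu> = "[x \<mapsto> s, y \<mapsto> t, v \<mapsto> URI p]"
        have "sat ?\<mu> C" using C[of ?\<mu> p] Q by simp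
        then have "?\<mu> \<in> {\<mu> \<in> ?\<Omega> u. \<mu> x = Some (URI u)}"
          using d xy v s by auto
        moreover have "\<mu>' = ?\<mu> |` {x, y}"
          using v by (auto simp: \<mu>' fun_eq_iff restrict_map_def)
        ultimately show "\<mu>' \<in> ?L"
          unfolding proj_def by blast
      qed
    qed
    finally show ?thesis
      unfolding sols_Var_Var[OF xy] mem_Collect_eq case_prod_conv .
  qed
  then have "expresses ?q (Var x) (Var y)
    (\<lambda>(data :: 'd \<Rightarrow> ('u, 'b, 'l) triple set) W.
      {(s, t). \<exists>p. Q p \<and> (s, URI p, t) \<in> ctxt_data data W s})"
    unfolding expresses_def by simp
  then show ?thesis ..
qed

lemma expresses_PPUri:
  fixes x y :: "'v::infinite"
  assumes "x \<noteq> y"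
  shows "\<exists>q :: ('u, 'l, 'v) query. expresses q (Var x) (Var y)
    (\<lambda>(data :: 'd \<Rightarrow> ('u, 'b, 'l) triple set) W. pp_rel data W (PPUri p))"
proof -
  have "\<exists>C :: ('u, 'l, 'v) condition. \<forall>(\<mu> :: ('u, 'b, 'l, 'v) smap) p'.
       \<mu> v = Some (URI p') \<longrightarrow> (sat \<mu> C \<longleftrightarrow> p' = p)" for v
    by (rule exI[of _ "EqConst v (CUri p)"]) simp
  from expresses_step[OF assms, of "\<lambda>p'. p' = p", OF this] show ?thesis
    by simp
qed

lemma expresses_PPNeg:
  fixes x y :: "'v::infinite"
  assumes "x \<noteq> y"
  shows "\<exists>q :: ('u, 'l, 'v) query. expresses q (Var x) (Var y)
    (\<lambda>(data :: 'd \<Rightarrow> ('u, 'b, 'l) triple set) W. pp_rel data W (PPNeg us))"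
proof -
  have "\<exists>C :: ('u, 'l, 'v) condition. \<forall>(\<mu> :: ('u, 'b, 'l, 'v) smap) p.
       \<mu> v = Some (URI p) \<longrightarrow> (sat \<mu> C \<longleftrightarrow> p \<notin> set us)" for v
  proof (induction us)
    case Nil
    \<comment> \<open>\<open>Bound v\<close> plays the condition true, since only mappings that bind
      \<open>v\<close> are considered.\<close>
    show ?case by (rule exI[of _ "Bound v"]) auto
  next
    case (Cons u us)
    then obtain C :: "('u, 'l, 'v) condition" where
      "\<forall>(\<mu> :: ('u, 'b, 'l, 'v) smap) p. \<mu> v = Some (URI p) \<longrightarrow> (sat \<mu> C \<longleftrightarrow> p \<notin> set us)"
      by blast
    then show ?case
      by (intro exI[of _ "CAnd (CNot (EqConst v (CUri u))) C"]) auto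
  qed
  from expresses_step[OF assms, of "\<lambda>p. p \<notin> set us", OF this] show ?thesis
    by simp
qed

section \<open>The identity on the terms of the Web\<close>

text \<open>Serves as the reflexive part of a star and for copying a variable endpoint to a fresh
  variable. Blank nodes and literals must be included, so the terms are collected by graph patterns
  rather than by navigation.\<close>

lemma expresses_Id_on_web_terms:
  fixes a x :: "'v::infinite"
  assumes ax: "a \<noteq> x"
  shows "\<exists>q :: ('u, 'l, 'v) query. expresses q (Var a) (Var x)
    (\<lambda>(data :: 'd \<Rightarrow> ('u, 'b, 'l) triple set) W. Id_on (web_terms data W))"
proof -
  obtain p where p: "p \<notin> {a, x}" using ex_distinct_fresh[of "{a, x}"] by auto
  obtain r where r: "r \<notin> {a, x, p}" using ex_distinct_fresh[of "{a, x, p}"] by auto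
  obtain w where w: "w \<notin> {a, x, p, r}" using ex_distinct_fresh[of "{a, x, p, r}"] by auto
  txt \<open>
    \<open>SEED ?w\<close> ranges over all URIs and hence reaches every document, because the lookup function
    of a Web is surjective; \<open>BIND\<close> duplicates the value of \<open>?a\<close>.
  \<close>
  let ?B = "PUnion (BGP {|(Var a, Var p, Var r)|})
    (PUnion (BGP {|(Var p, Var a, Var r)|}) (BGP {|(Var p, Var r, Var a)|}))"
  let ?P = "PBind ?B (Var a) x"
  let ?q = "QProj {|a, x|} (QSeedVar w (QBasic LEps ?P))"
  have eval: "eval_query data W ?q S = sols (Var a) (Var x) (Id_on (web_terms data W))"
    if W: "valid_web W"
    for data :: "'d \<Rightarrow> ('u, 'b, 'l) triple set" and W S
  proof -
    let ?G = "\<lambda>u. case adoc W u of None \<Rightarrow> {} | Some d \<Rightarrow> data d"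
    let ?T = "\<lambda>t t1 t2 u. (t, t1, t2) \<in> ?G u \<or> (t1, t, t2) \<in> ?G u \<or> (t1, t2, t) \<in> ?G u"
    let ?\<Omega> = "\<lambda>u. {\<mu>. dom \<mu> = {a, p, r} \<and>
      (\<exists>t t1 t2. \<mu> a = Some t \<and> \<mu> p = Some t1 \<and> \<mu> r = Some t2 \<and> ?T t t1 t2 u)}"
    let ?\<Omega>' = "\<lambda>u. {\<mu>(x \<mapsto> t) | \<mu> t. \<mu> \<in> ?\<Omega> u \<and> \<mu> a = Some t}"
    \<comment> \<open>All three basic patterns bind the same variables, so their union is a single
      set with a three-way disjunction on the position of the term.\<close>
    have perm: "{p, a, r} = {a, p, r}" "{p, r, a} = {a, p, r}"
      by auto
    have B: "eval_pattern DS (?G u) ?B = ?\<Omega> u" for DS u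
      unfolding eval_pattern.simps(3) eval_pattern_BGP_Vars perm Collect_disj_eq[symmetric]
      by (intro Collect_cong) metis
    have P: "eval_pattern DS (?G u) ?P = ?\<Omega>' u" for DS u
    proof -
      have "eval_pattern DS (?G u) ?P =
          (\<lambda>\<mu>. case \<mu> a of None \<Rightarrow> \<mu> | Some t \<Rightarrow> \<mu>(x \<mapsto> t)) ` ?\<Omega> u"
        unfolding eval_pattern.simps(8) subst.simps B ..
      \<comment> \<open>Every solution of \<open>?B\<close> binds \<open>a\<close>, so
        \<open>BIND\<close> never leaves a mapping unchanged.\<close>
      also have "\<dots> = (\<lambda>\<mu>. \<mu>(x \<mapsto> the (\<mu> a))) ` ?\<Omega> u"
        by (rule image_cong) auto
      also have "\<dots> = ?\<Omega>' u" (is "?f ` _ = _")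
      proof
        show "?f ` ?\<Omega> u \<subseteq> ?\<Omega>' u"
        proof
          fix \<nu> assume "\<nu> \<in> ?f ` ?\<Omega> u"
          then obtain \<mu> where \<mu>: "\<nu> = ?f \<mu>" "\<mu> \<in> ?\<Omega> u" by (rule imageE)
          from \<mu>(2) obtain t where t: "\<mu> a = Some t" by blast
          with \<mu>(1) have "\<nu> = \<mu>(x \<mapsto> t)" by simp
          with \<mu>(2) t show "\<nu> \<in> ?\<Omega>' u" by blast
        qed
      next
        show "?\<Omega>' u \<subseteq> ?f ` ?\<Omega> u"
        proof
          fix \<nu> assume "\<nu> \<in> ?\<Omega>' u"
          then obtain \<mu> t where "\<nu> = \<mu>(x \<mapsto> t)" "\<mu> \<in> ?\<Omega> u" "\<mu> a = Some t" by blast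
          then have "\<nu> = ?f \<mu>" "\<mu> \<in> ?\<Omega> u" by simp_all
          then show "\<nu> \<in> ?f ` ?\<Omega> u" by (rule image_eqI)
        qed
      qed
      finally show ?thesis .
    qed
    have e: "eval_query data W (QBasic LEps ?P) {u} = ?\<Omega>' u" for u
      unfolding eval_query_LEps_singleton Let_def default_graph_singleton P ..
    have j: "join (?\<Omega>' u) {[w \<mapsto> URI u]} = (\<lambda>\<mu>. \<mu>(w \<mapsto> URI u)) ` ?\<Omega>' u" for u
      by (rule join_singleton_unbound) (use w in auto)
    have "eval_query data W ?q S = proj {a, x} (\<Union>u. (\<lambda>\<mu>. \<mu>(w \<mapsto> URI u)) ` ?\<Omega>' u)"
      unfolding eval_query.simps(6) eval_query.simps(3) e j by (simp only: fset_simps)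
    also have "\<dots> = {[a \<mapsto> s, x \<mapsto> t] | s t. (s, t) \<in> Id_on (web_terms data W)}" (is "?L = ?R")
    proof
      show "?L \<subseteq> ?R"
      proof
        fix \<mu>' assume "\<mu>' \<in> ?L"
        then obtain u \<nu> where \<nu>: "\<nu> \<in> ?\<Omega>' u" "\<mu>' = (\<nu>(w \<mapsto> URI u)) |` {a, x}"
          unfolding proj_def by blast
        from \<nu>(1) obtain \<mu> t where \<mu>: "\<nu> = \<mu>(x \<mapsto> t)" "\<mu> \<in> ?\<Omega> u" "\<mu> a = Some t"
          by blast
        from \<mu>(2,3) obtain t1 t2 where T: "?T t t1 t2 u" by auto
        from T obtain d where d: "adoc W u = Some d"
          "(t, t1, t2) \<in> data d \<or> (t1, t, t2) \<in> data d \<or> (t1, t2, t) \<in> data d"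
          by (auto split: option.splits)
        have "d \<in> docs W" using W d(1) by (auto simp: valid_web_def ran_def)
        with d(2) have "t \<in> web_terms data W"
          unfolding web_terms_iff by blast
        moreover have "\<mu>' = [a \<mapsto> t, x \<mapsto> t]"
          using ax w \<mu>(3) by (auto simp: \<nu>(2) \<mu>(1) fun_eq_iff restrict_map_def)
        ultimately show "\<mu>' \<in> ?R" by blast
      qed
    next
      show "?R \<subseteq> ?L"
      proof
        fix \<mu>' assume "\<mu>' \<in> ?R"
        then obtain t where \<mu>': "\<mu>' = [a \<mapsto> t, x \<mapsto> t]" and t: "t \<in> web_terms data W"
          by auto
        then obtain d t1 t2 where d: "d \<in> docs W"
          "(t, t1, t2) \<in> data d \<or> (t1, t, t2) \<in> data d \<or> (t1, t2, t) \<in> data d"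
          unfolding web_terms_iff by blast
        from d(1) obtain u where u: "adoc W u = Some d"
          using W by (auto simp: valid_web_def ran_def)
        let ?\<mu> = "[a \<mapsto> t, p \<mapsto> t1, r \<mapsto> t2]"
        have "?\<mu> \<in> ?\<Omega> u" using d(2) u p r by auto
        moreover have "?\<mu> a = Some t" using p r by auto
        ultimately have "?\<mu>(x \<mapsto> t) \<in> ?\<Omega>' u" by blast
        then have "?\<mu>(x \<mapsto> t, w \<mapsto> URI u) \<in> (\<Union>u. (\<lambda>\<mu>. \<mu>(w \<mapsto> URI u)) ` ?\<Omega>' u)"
          by (intro UN_I[of u] imageI UNIV_I)
        moreover have "\<mu>' = ((?\<mu>(x \<mapsto> t))(w \<mapsto> URI u)) |` {a, x}"
          using ax p r w by (auto simp: \<mu>' fun_eq_iff restrict_map_def)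
        ultimately show "\<mu>' \<in> ?L"
          unfolding proj_def by (rule image_eqI[where f = "\<lambda>\<mu>. \<mu> |` {a, x}", rotated])
      qed
    qed
    finally show ?thesis
      unfolding sols_Var_Var[OF ax] .
  qed
  \<comment> \<open>\<open>BIND\<close> requires a target that does not occur in \<open>?B\<close>;
    this follows from \<open>ax\<close> and the choice of \<open>p\<close> and
    \<open>r\<close>.\<close>
  have wf: "wf_query ?q"
    using ax p r by (auto simp: bgp_vars_def tp_vars_def)
  have "expresses ?q (Var a) (Var x)
    (\<lambda>(data :: 'd \<Rightarrow> ('u, 'b, 'l) triple set) W. Id_on (web_terms data W))"
    unfolding expresses_def by (intro conjI allI impI wf eval)
  then show ?thesis ..
qed

section \<open>Iteration of link path expressions and the star\<close>

lemma eval_lpe_outside: "u \<notin> dom (adoc W) \<Longrightarrow> eval_lpe data W l u = {}"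
  by (cases l) auto

text \<open>A URI without a document is a dead end, as every link path expression is empty there.
  Intermediate nodes therefore lie in \<open>dom (adoc W)\<close> anyway, and only the final one has
  to be intersected with it.\<close>

lemma eval_lpe_iter:
  assumes l: "\<And>u. u \<in> dom (adoc W) \<Longrightarrow> eval_lpe data W l u = {u'. (u, u') \<in> D}"
    and u: "u \<in> dom (adoc W)"
  shows "eval_lpe data W (lpe_iter l n) u \<inter> dom (adoc W) =
    {u'. (u, u') \<in> (D \<inter> dom (adoc W) \<times> dom (adoc W)) ^^ Suc n}" (is "_ = {u'. _ \<in> ?D ^^ Suc n}")
  using u
proof (induction n arbitrary: u)
  case 0
  then show ?case using l by auto
next
  case (Suc n)
  have "eval_lpe data W (lpe_iter l (Suc n)) u \<inter> dom (adoc W) =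
      (\<Union>u'\<in>{u'. (u, u') \<in> D}. eval_lpe data W (lpe_iter l n) u' \<inter> dom (adoc W))"
    using Suc.prems l by auto
  also have "\<dots> = (\<Union>u'\<in>{u'. (u, u') \<in> ?D}. eval_lpe data W (lpe_iter l n) u' \<inter> dom (adoc W))"
    using Suc.prems eval_lpe_outside[of _ W data] by fast
  also have "\<dots> = (\<Union>u'\<in>{u'. (u, u') \<in> ?D}. {v. (u', v) \<in> ?D ^^ Suc n})"
    by (rule SUP_cong[OF refl]) (use Suc.IH in blast)
  also have "\<dots> = {v. (u, v) \<in> ?D O ?D ^^ Suc n}"
    by blast
  also have "?D O ?D ^^ Suc n = ?D ^^ Suc (Suc n)"
    by (metis relpow.simps(2) relpow_commute)
  finally show ?case .
qed

text \<open>The iterates give all positive powers; the start \<open>u\<close> supplies the zeroth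
  and survives the intersection because it has a document.\<close>

lemma eval_lpe_LStar:
  assumes l: "\<And>u. u \<in> dom (adoc W) \<Longrightarrow> eval_lpe data W l u = {u'. (u, u') \<in> D}"
    and u: "u \<in> dom (adoc W)"
  shows "eval_lpe data W (LStar l) u \<inter> dom (adoc W) =
    {u'. (u, u') \<in> (D \<inter> dom (adoc W) \<times> dom (adoc W))\<^sup>*}" (is "_ = {u'. _ \<in> ?D\<^sup>*}")
proof -
  have iter: "eval_lpe data W (lpe_iter l n) u \<inter> dom (adoc W) = {u'. (u, u') \<in> ?D ^^ Suc n}" for n
    using l u by (rule eval_lpe_iter)
  have "eval_lpe data W (LStar l) u \<inter> dom (adoc W) =
      {u} \<union> (\<Union>n. eval_lpe data W (lpe_iter l n) u \<inter> dom (adoc W))"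
    using u by auto
  also have "\<dots> = {u} \<union> (\<Union>n. {u'. (u, u') \<in> ?D ^^ Suc n})"
    by (simp only: iter)
  also have "\<dots> = {u'. u' = u \<or> (\<exists>n>0. (u, u') \<in> ?D ^^ n)}"
    unfolding gr0_conv_Suc by blast
  also have "\<dots> = {u'. (u, u') \<in> ?D\<^sup>*}"
    unfolding trancl_power[symmetric] rtrancl_eq_or_trancl by blast
  finally show ?thesis .
qed

text \<open>The empty basic graph pattern has the empty mapping as its only solution over any graph,
  even an empty one, so \<open>GRAPH\<close> just enumerates the names of the dataset. Names are
  URIs with a document, hence the intersection.\<close>

lemma eval_query_names:
  fixes data :: "'d \<Rightarrow> ('u, 'b, 'l) triple set" and x :: 'v
  shows "eval_query data W (QBasic l (PGraph (Var x) (BGP {||}))) S =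
    {[x \<mapsto> URI u] | u. u \<in> (\<Union>u\<in>S. eval_lpe data W l u) \<inter> dom (adoc W)}"
proof -
  have empty: "eval_pattern DS G (BGP {||} :: ('u, 'l, 'v) pattern) = {Map.empty}"
    for DS :: "('u, 'b, 'l) dataset" and G
    by (auto simp: bgp_vars_def)
  have join: "join {Map.empty} {[x \<mapsto> t]} = {[x \<mapsto> t]}" for t :: "('u, 'b, 'l) rdf_term"
    by (subst join_singleton_unbound) auto
  have names: "dom (named_graph (web_dataset data W U)) = U \<inter> dom (adoc W)" for U
    by (auto simp: web_dataset_def split: if_splits)
  show ?thesis
    unfolding eval_query.simps(1) Let_def eval_pattern.simps(7) empty join names by blast
qed

lemma Id_on_Un_trancl:
  assumes T: "R \<subseteq> T \<times> T" and D: "\<And>s t. (s, t) \<in> R \<Longrightarrow> s = t \<or> s \<in> f ` A"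
    and f: "inj f"
  defines "E \<equiv> {(u, u'). (f u, f u') \<in> R} \<inter> A \<times> A"
  shows "Id_on T \<union> R\<^sup>+ = Id_on T \<union> {(f u, f u') | u u'. u \<in> A \<and> (u, u') \<in> E\<^sup>*} O R"
    (is "_ = _ \<union> ?C O R")
proof
  have "(s, t) \<in> Id_on T \<union> ?C O R" if "(s, t) \<in> R\<^sup>+" for s t
    using that
  \<comment> \<open>Steps are prepended, so that the final step of \<open>R\<close> stays in
    place.\<close>
  proof (induction rule: converse_trancl_induct)
    case (base s)
    then show ?case using D[OF base] T by blast
  next
    case (step r s)
    from D[OF step.hyps(1)] show ?case
    proof
      assume "r = s" then show ?thesis using step.IH by simp
    next
      assume "r \<in> f ` A"
      then obtain u where u: "r = f u" "u \<in> A" by blast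
      from step.IH show ?thesis
      proof
        assume "(s, t) \<in> Id_on T"
        \<comment> \<open>The tail has collapsed, so the new step is itself the final one, preceded
          by an empty walk.\<close>
        then have "(r, t) \<in> R" using step.hyps(1) by auto
        then show ?thesis using u by blast
      next
        assume "(s, t) \<in> ?C O R"
        then obtain v v' where v: "s = f v" "v \<in> A" "(v, v') \<in> E\<^sup>*" "(f v', t) \<in> R" by auto
        \<comment> \<open>The tail starts in the image of \<open>A\<close>, so the new step has both
          ends there and extends the walk.\<close>
        then have "(u, v) \<in> E" using u step.hyps(1) by (simp add: E_def)
        then have "(u, v') \<in> E\<^sup>*" using v(3) by (rule converse_rtrancl_into_rtrancl)
        then show ?thesis using u v(4) by blast
      qed
    qed
  qed
  then show "Id_on T \<union> R\<^sup>+ \<subseteq> Id_on T \<union> ?C O R" by auto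
next
  have "(f u, f u') \<in> R\<^sup>*" if "(u, u') \<in> E\<^sup>*" for u u'
    using that by (induction rule: rtrancl_induct) (auto simp: E_def)
  then show "Id_on T \<union> ?C O R \<subseteq> Id_on T \<union> R\<^sup>+"
    by (auto intro: rtrancl_into_trancl1)
qed

text \<open>Follows the decomposition in \<open>Id_on_Un_trancl\<close>: the walk \<open>?C\<close>
  is navigated by \<open>LStar\<close>, while the reflexive part and the last step are ordinary
  queries. The hypothesis is needed for two pairs of variables, since the last step starts at the
  fresh variable \<open>z\<close>.\<close>

lemma expresses_PPStar:
  fixes x y :: "'v::infinite" and pe :: "'u pp"
  assumes xy: "x \<noteq> y"
    and IH: "\<And>x y. x \<noteq> y \<Longrightarrow> \<exists>q :: ('u, 'l, 'v) query. expresses q (Var x) (Var y)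
      (\<lambda>(data :: 'd \<Rightarrow> ('u, 'b, 'l) triple set) W. pp_rel data W pe)"
  shows "\<exists>q :: ('u, 'l, 'v) query. expresses q (Var x) (Var y)
    (\<lambda>(data :: 'd \<Rightarrow> ('u, 'b, 'l) triple set) W. pp_rel data W (PPStar pe))"
proof -
  obtain z where z: "z \<noteq> x" "z \<noteq> y"
    using ex_distinct_fresh[of "{x, y}"] by auto
  obtain q where q: "expresses q (Var x) (Var y)
      (\<lambda>(data :: 'd \<Rightarrow> ('u, 'b, 'l) triple set) W. pp_rel data W pe)"
    using IH[OF xy] by blast
  obtain q' where q': "expresses q' (Var z) (Var y)
      (\<lambda>(data :: 'd \<Rightarrow> ('u, 'b, 'l) triple set) W. pp_rel data W pe)"
    using IH[OF z(2)] by blast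
  obtain i where i: "expresses i (Var x) (Var y)
      (\<lambda>(data :: 'd \<Rightarrow> ('u, 'b, 'l) triple set) W. Id_on (web_terms data W))"
    using expresses_Id_on_web_terms[OF xy] by blast
  txt \<open>
    The pattern \<open>GRAPH ?v {}\<close> binds \<open>?v\<close> to the URIs selected by \<open>l\<close>. In \<open>?l\<close> it makes the
    context URI available to the query, which otherwise does not depend on its context.
  \<close>
  let ?names = "\<lambda>l v. QBasic l (PGraph (Var v) (BGP {||})) :: ('u, 'l, 'v) query"
  let ?l = "LQuery y (QAnd (?names LEps x) q)"
  let ?c = "QSeedVar x (?names (LStar ?l) z)"
  let ?E = "\<lambda>(data :: 'd \<Rightarrow> ('u, 'b, 'l) triple set) W.
    {(u, u'). (URI u, URI u') \<in> pp_rel data W pe} \<inter> dom (adoc W) \<times> dom (adoc W)"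
  let ?C = "\<lambda>(data :: 'd \<Rightarrow> ('u, 'b, 'l) triple set) W.
    {(URI u, URI u') | u u'. u \<in> dom (adoc W) \<and> (u, u') \<in> (?E data W)\<^sup>*}"
  have eval: "eval_query data W ?c S = sols (Var x) (Var z) (?C data W)"
    if D: "valid_data data" and W: "valid_web W"
    for data :: "'d \<Rightarrow> ('u, 'b, 'l) triple set" and W S
  proof -
    let ?A = "dom (adoc W)"
    have qR: "eval_query data W q {u} =
        {[x \<mapsto> s, y \<mapsto> t] | s t. (s, t) \<in> pp_rel data W pe}" for u
      using q D W xy by (simp add: expresses_def sols_Var_Var)
    \<comment> \<open>One move of \<open>?l\<close> traverses \<open>pe\<close> once from the
      context URI: the conjunction fixes the first component, and \<open>LQuery\<close> keeps only
      values of \<open>y\<close> that are URIs.\<close>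
    have l: "eval_lpe data W ?l u = {u'. (u, u') \<in> {(u, u'). (URI u, URI u') \<in> pp_rel data W pe}}"
      if u: "u \<in> ?A" for u
    proof -
      have n: "eval_query data W (?names LEps x) {u} = {[x \<mapsto> URI u]}"
        unfolding eval_query_names using u by auto
      have c: "compatible [x \<mapsto> URI u] [x \<mapsto> s, y \<mapsto> t] \<longleftrightarrow> s = URI u"
        for s t :: "('u, 'b, 'l) rdf_term"
        using xy by (auto simp: compatible_def)
      have eval: "eval_query data W (QAnd (?names LEps x) q) {u} =
          {[x \<mapsto> URI u, y \<mapsto> t] | t. (URI u, t) \<in> pp_rel data W pe}"
        (is "_ = ?R")
      proof
        show "?R \<subseteq> eval_query data W (QAnd (?names LEps x) q) {u}"
        proof
          fix \<mu> assume "\<mu> \<in> ?R"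
          then obtain t where t: "\<mu> = [x \<mapsto> URI u, y \<mapsto> t]" "(URI u, t) \<in> pp_rel data W pe"
            by blast
          then have "\<mu> = [x \<mapsto> URI u] ++ [x \<mapsto> URI u, y \<mapsto> t]" by (auto simp: fun_eq_iff)
          then show "\<mu> \<in> eval_query data W (QAnd (?names LEps x) q) {u}"
            unfolding eval_query.simps(4) n qR join_def using t(2) c by blast
        qed
      next
        show "eval_query data W (QAnd (?names LEps x) q) {u} \<subseteq> ?R"
        proof
          fix \<mu> assume "\<mu> \<in> eval_query data W (QAnd (?names LEps x) q) {u}"
          then obtain s t where t: "\<mu> = [x \<mapsto> URI u] ++ [x \<mapsto> s, y \<mapsto> t]"
            "(s, t) \<in> pp_rel data W pe" "compatible [x \<mapsto> URI u] [x \<mapsto> s, y \<mapsto> t]"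
            unfolding eval_query.simps(4) n qR join_def by blast
          from c t(3) have "s = URI u" by (rule iffD1)
          moreover from this have "\<mu> = [x \<mapsto> URI u, y \<mapsto> t]"
            unfolding t(1) by (auto simp: fun_eq_iff)
          ultimately show "\<mu> \<in> ?R"
            using t(2) by blast
        qed
      qed
      show ?thesis
        unfolding eval_lpe.simps(7) eval using u xy by auto
    qed
    have s: "eval_query data W (?names (LStar ?l) z) {u} =
        (if u \<in> ?A then {[z \<mapsto> URI u'] | u'. (u, u') \<in> (?E data W)\<^sup>*} else {})" for u
    proof (cases "u \<in> ?A")
      case True
      have star: "eval_lpe data W (LStar ?l) u \<inter> ?A = {u'. (u, u') \<in> (?E data W)\<^sup>*}"
        using l True by (rule eval_lpe_LStar)
      show ?thesis
        unfolding eval_query_names UN_insert UN_empty Un_empty_right star using True by auto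
    next
      case False
      then show ?thesis
        unfolding eval_query_names UN_insert UN_empty eval_lpe_outside[OF False] by simp
    qed
    \<comment> \<open>The inner query binds only \<open>z\<close>, so seeding \<open>x\<close>
      records the start of the walk beside its end.\<close>
    have j: "join (eval_query data W (?names (LStar ?l) z) {u}) {[x \<mapsto> URI u]} =
        {[x \<mapsto> URI u, z \<mapsto> URI u'] | u'. u \<in> ?A \<and> (u, u') \<in> (?E data W)\<^sup>*}" for u
    proof -
      have "join (eval_query data W (?names (LStar ?l) z) {u}) {[x \<mapsto> URI u]} =
          (\<lambda>\<mu>. \<mu>(x \<mapsto> URI u)) ` eval_query data W (?names (LStar ?l) z) {u}"
        by (rule join_singleton_unbound, unfold s) (use z in \<open>auto split: if_splits\<close>)
      also have "\<dots> = {[z \<mapsto> URI u', x \<mapsto> URI u] | u'. u \<in> ?A \<and> (u, u') \<in> (?E data W)\<^sup>*}"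
        unfolding s by auto
      finally show ?thesis
        by (simp only: fun_upd_twist[OF z(1)])
    qed
    have "eval_query data W ?c S = {[x \<mapsto> s, z \<mapsto> t] | s t. (s, t) \<in> ?C data W}"
      unfolding eval_query.simps(3) j by blast
    then show ?thesis
      unfolding sols_Var_Var[OF z(1)[symmetric]] .
  qed
  have wf: "wf_query ?c"
    using q by (simp add: expresses_def)
  have "expresses ?c (Var x) (Var z) ?C"
    unfolding expresses_def by (intro conjI allI impI wf eval)
  \<comment> \<open>The last step is taken outside the link path expression, as it may end at a
    blank node or a literal.\<close>
  then obtain c' where "expresses c' (Var x) (Var y) (\<lambda>data W. ?C data W O pp_rel data W pe)"
    using expresses_comp[OF _ _ q', of "Var x"] z by auto
  from expresses_Un[OF i this]
  have "expresses (QUnion i c') (Var x) (Var y)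
      (\<lambda>data W. Id_on (web_terms data W) \<union> ?C data W O pp_rel data W pe)" .
  then have "expresses (QUnion i c') (Var x) (Var y)
      (\<lambda>(data :: 'd \<Rightarrow> ('u, 'b, 'l) triple set) W. pp_rel data W (PPStar pe))"
  proof (rule expresses_cong)
    show "Id_on (web_terms data W) \<union> ?C data W O pp_rel data W pe = pp_rel data W (PPStar pe)"
      if "valid_web W" for data :: "'d \<Rightarrow> ('u, 'b, 'l) triple set" and W
      unfolding pp_rel.simps
      by (rule Id_on_Un_trancl[OF pp_rel_subset[OF that], symmetric])
        (erule pp_rel_domain, simp add: inj_def)
  qed
  then show ?thesis ..
qed

section \<open>All path expressions, first between distinct variables, then between arbitrary
  endpoints\<close>

lemma expresses_pp_rel:
  fixes x y :: "'v::infinite" and pe :: "'u pp"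
  assumes "x \<noteq> y"
  shows "\<exists>q :: ('u, 'l, 'v) query. expresses q (Var x) (Var y)
    (\<lambda>(data :: 'd \<Rightarrow> ('u, 'b, 'l) triple set) W. pp_rel data W pe)"
  using assms
proof (induction pe arbitrary: x y)
  case (PPUri p)
  then show ?case by (rule expresses_PPUri)
next
  case (PPNeg us)
  then show ?case by (rule expresses_PPNeg)
next
  case (PPSeq pe1 pe2)
  obtain z where z: "z \<noteq> x" "z \<noteq> y"
    using ex_distinct_fresh[of "{x, y}"] by auto
  from PPSeq.IH(1)[of x z] PPSeq.IH(2)[of z y] z obtain q1 q2 :: "('u, 'l, 'v) query" where
    "expresses q1 (Var x) (Var z) (\<lambda>(data :: 'd \<Rightarrow> ('u, 'b, 'l) triple set) W. pp_rel data W pe1)"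
    "expresses q2 (Var z) (Var y) (\<lambda>(data :: 'd \<Rightarrow> ('u, 'b, 'l) triple set) W. pp_rel data W pe2)"
    by auto
  from expresses_comp[OF _ this] z show ?case by simp
next
  case (PPAlt pe1 pe2)
  then obtain q1 q2 :: "('u, 'l, 'v) query" where
    "expresses q1 (Var x) (Var y) (\<lambda>(data :: 'd \<Rightarrow> ('u, 'b, 'l) triple set) W. pp_rel data W pe1)"
    "expresses q2 (Var x) (Var y) (\<lambda>(data :: 'd \<Rightarrow> ('u, 'b, 'l) triple set) W. pp_rel data W pe2)"
    by blast
  from expresses_Un[OF this] show ?case by auto
next
  case (PPStar pe)
  then show ?case by (rule expresses_PPStar[rotated])
qed

text \<open>
  A constant need not occur in the Web, so only a relation between the identity on the terms of
  the Web and the full identity is obtained.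
\<close>

lemma expresses_endpoint:
  fixes x :: "'v::infinite"
  assumes x: "x \<notin> pos_vars \<alpha>"
  shows "\<exists>(q :: ('u, 'l, 'v) query) I. expresses q \<alpha> (Var x) I \<and>
    (\<forall>(data :: 'd \<Rightarrow> ('u, 'b, 'l) triple set) W. Id_on (web_terms data W) \<subseteq> I data W \<and> I data W \<subseteq> Id)"
proof (cases \<alpha>)
  case (Const c)
  \<comment> \<open>The empty pattern has exactly one solution on every Web, so \<open>BIND\<close>
    produces exactly one mapping.\<close>
  let ?q = "QBasic LEps (PBind (BGP {||}) (Const c) x) :: ('u, 'l, 'v) query"
  have "\<mu> \<in> sols \<alpha> (Var x) Id \<longleftrightarrow> \<mu> = [x \<mapsto> term_of_const c]" for \<mu> :: "('u, 'b, 'l, 'v) smap"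
  proof
    assume "\<mu> \<in> sols \<alpha> (Var x) Id"
    then have "dom \<mu> = {x}" "\<mu> x = Some (term_of_const c)" by (auto simp: sols_def Const)
    then show "\<mu> = [x \<mapsto> term_of_const c]"
      by (metis dom_eq_singleton_conv option.inject fun_upd_same)
  qed (simp add: sols_def Const)
  then have "sols \<alpha> (Var x) Id = {[x \<mapsto> term_of_const c :: ('u, 'b, 'l) rdf_term]}"
    by blast
  then have "expresses ?q \<alpha> (Var x) (\<lambda>(data :: 'd \<Rightarrow> ('u, 'b, 'l) triple set) W. Id)"
    by (simp add: expresses_def Let_def bgp_vars_def fun_upd_def)
  then show ?thesis by blast
next
  case (Var a)
  \<comment> \<open>Copying a variable reaches precisely the terms of the Web, the lower bound
    allowed for \<open>I\<close>.\<close>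
  with x have "a \<noteq> x" by auto
  from expresses_Id_on_web_terms[OF this] show ?thesis
    unfolding Var by blast
qed

theorem theorem2:
  fixes \<alpha> \<beta> :: "('u::infinite, 'l::infinite, 'v::infinite) pat_term"
    and pe :: "'u pp"
  shows "\<exists>q :: ('u, 'l, 'v) query. wf_query q \<and>
    (\<forall>(data :: 'd::infinite \<Rightarrow> ('u, 'b::infinite, 'l) triple set) (W :: ('u, 'd) web).
       valid_data data \<longrightarrow> valid_web W \<longrightarrow>
       eval_pp data W \<alpha> pe \<beta> = eval_query data W q {})"
proof -
  have fin: "finite (pos_vars \<alpha> \<union> pos_vars \<beta>)"
    by (cases \<alpha>; cases \<beta>) auto
  obtain x where x: "x \<notin> pos_vars \<alpha> \<union> pos_vars \<beta>"
    using ex_distinct_fresh[OF fin] by blast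
  obtain y where y: "y \<notin> insert x (pos_vars \<alpha> \<union> pos_vars \<beta>)"
    using ex_distinct_fresh[of "insert x (pos_vars \<alpha> \<union> pos_vars \<beta>)"] fin by blast
  obtain qx :: "('u, 'l, 'v) query" and I where qx: "expresses qx \<alpha> (Var x) I"
    and I: "\<And>(data :: 'd \<Rightarrow> ('u, 'b, 'l) triple set) W.
      Id_on (web_terms data W) \<subseteq> I data W \<and> I data W \<subseteq> Id"
    using expresses_endpoint[of x \<alpha>] x by blast
  obtain qy :: "('u, 'l, 'v) query" and J where qy: "expresses qy \<beta> (Var y) J"
    and J: "\<And>(data :: 'd \<Rightarrow> ('u, 'b, 'l) triple set) W.
      Id_on (web_terms data W) \<subseteq> J data W \<and> J data W \<subseteq> Id"
    using expresses_endpoint[of y \<beta>] y by blast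
  \<comment> \<open>\<open>expresses_endpoint\<close> puts the new variable second; at the right end
    it has to come first.\<close>
  have qy': "expresses qy (Var y) \<beta> (\<lambda>data W. (J data W)\<inverse>)"
    using qy by (simp add: expresses_converse)
  obtain q0 :: "('u, 'l, 'v) query" where q0: "expresses q0 (Var x) (Var y)
      (\<lambda>(data :: 'd \<Rightarrow> ('u, 'b, 'l) triple set) W. pp_rel data W pe)"
    using expresses_pp_rel[of x y] y by blast
  obtain q1 where q1: "expresses q1 \<alpha> (Var y) (\<lambda>data W. I data W O pp_rel data W pe)"
    using expresses_comp[OF _ qx q0] x y by auto
  obtain q where q: "expresses q \<alpha> \<beta> (\<lambda>data W. (I data W O pp_rel data W pe) O (J data W)\<inverse>)"
    using expresses_comp[OF _ q1 qy'] y by auto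
  from q have "expresses q \<alpha> \<beta> (\<lambda>(data :: 'd \<Rightarrow> ('u, 'b, 'l) triple set) W. pp_rel data W pe)"
  proof (rule expresses_cong)
    \<comment> \<open>Both outer factors are partial identities defined at least on the terms of the
      Web, to which \<open>pp_rel\<close> is confined.\<close>
    show "(I data W O pp_rel data W pe) O (J data W)\<inverse> = pp_rel data W pe"
      if "valid_web W" for data :: "'d \<Rightarrow> ('u, 'b, 'l) triple set" and W
      using pp_rel_subset[OF that, of data pe] I[of data W] J[of data W] by blast
  qed
  then show ?thesis
    unfolding expresses_def eval_pp_eq_sols by blast
qed

end
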